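(* Suppose that for each subsolution $u$ the functions $T_c^-u$ and $-T_c^+u$ are locally semiconcave on $M$. Then the set of locally $C^{1,1}$ subsolutions is dense in the set of continuous subsolutions for the strong (Whitney) topology on $C^0(M,\mathbb{R})$.
   Context: $M$ is a smooth connected Riemannian manifold, and $c:M\times M\to\mathbb{R}$ is a given function (the cost). A function $u:M\to\mathbb{R}$ (not assumed continuous) is called a subsolution if $u(y)-u(x)\leq c(x,y)$ for all $(x,y)\in M\times M$. The discrete Lax--Oleinik operators are $T_c^-u(x)=\inf_{y\in M}\big(u(y)+c(y,x)\big)$ and $T_c^+u(x)=\sup_{y\in M}\big(u(y)-c(x,y)\big)$. A function is locally semiconcave (with linear modulus) if each point has a chart neighbourhood in which the function is the sum of a concave function and a smooth function. A function is locally $C^{1,1}$ if it is $C^1$ with locally Lipschitz differential. The strong (Whitney) topology on $C^0(M,\mathbb{R})$ is the one having as a basis of open sets the sets $O_{\epsilon,f}=\{g\in C^0(M,\mathbb{R}) : \forall x\in M,\ |f(x)-g(x)|<\epsilon(x)\}$, where $f\in C^0(M,\mathbb{R})$ and $\epsilon:M\to(0,\infty)$ is continuous. *)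

theory Defs
  imports "HOL-Analysis.Analysis"
begin

text \<open>A function between Euclidean spaces is \<open>C\<^sup>k\<close> on an open set iff it is differentiable there
  and all its directional derivatives are \<open>C\<^sup>k\<^sup>-\<^sup>1\<close>. The definitions below are only
  meant for open \<open>S\<close>.\<close>

primrec Ck_on :: "nat \<Rightarrow> 'e::euclidean_space set \<Rightarrow> ('e \<Rightarrow> 'f::real_normed_vector) \<Rightarrow> bool" where
  "Ck_on 0 S F \<longleftrightarrow> continuous_on S F"
| "Ck_on (Suc k) S F \<longleftrightarrow>
     (\<forall>p\<in>S. F differentiable (at p)) \<and> (\<forall>v. Ck_on k S (\<lambda>p. frechet_derivative F (at p) v))"

definition smooth_on :: "'e::euclidean_space set \<Rightarrow> ('e \<Rightarrow> 'f::real_normed_vector) \<Rightarrow> bool" where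
  "smooth_on S F \<longleftrightarrow> (\<forall>k. Ck_on k S F)"

definition C11_on :: "'e::euclidean_space set \<Rightarrow> ('e \<Rightarrow> real) \<Rightarrow> bool" where
  "C11_on S F \<longleftrightarrow> (\<exists>F' :: 'e \<Rightarrow> 'e \<Rightarrow>\<^sub>L real.
     (\<forall>p\<in>S. (F has_derivative blinfun_apply (F' p)) (at p)) \<and>
     continuous_on S F' \<and>
     (\<forall>p\<in>S. \<exists>r>0. \<exists>L. L-lipschitz_on (ball p r \<inter> S) F'))"

text \<open>A manifold is a whole (Hausdorff, second countable) type \<open>'a\<close> with an atlas of charts
  \<open>(U, \<phi>)\<close> into a Euclidean space \<open>'e\<close>. The values of \<open>\<phi>\<close> outside \<open>U\<close> are
  irrelevant, and \<open>chart_inv (U, \<phi>)\<close> is the inverse of \<open>\<phi>\<close> on \<open>\<phi> ` U\<close>.\<close>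

type_synonym ('a, 'e) chart = "'a set \<times> ('a \<Rightarrow> 'e)"

definition chart_dom :: "('a, 'e) chart \<Rightarrow> 'a set" where
  "chart_dom C = fst C"

definition chart_map :: "('a, 'e) chart \<Rightarrow> 'a \<Rightarrow> 'e" where
  "chart_map C = snd C"

definition chart_img :: "('a, 'e) chart \<Rightarrow> 'e set" where
  "chart_img C = chart_map C ` chart_dom C"

definition chart_inv :: "('a, 'e) chart \<Rightarrow> 'e \<Rightarrow> 'a" where
  "chart_inv C = inv_into (chart_dom C) (chart_map C)"

definition is_chart :: "('a::topological_space, 'e::euclidean_space) chart \<Rightarrow> bool" where
  "is_chart C \<longleftrightarrow> open (chart_dom C) \<and> open (chart_img C) \<and>
     homeomorphism (chart_dom C) (chart_img C) (chart_map C) (chart_inv C)"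

definition transition :: "('a, 'e) chart \<Rightarrow> ('a, 'e) chart \<Rightarrow> 'e \<Rightarrow> 'e" where
  "transition C D = chart_map D \<circ> chart_inv C"

definition smooth_compatible :: "('a, 'e::euclidean_space) chart \<Rightarrow> ('a, 'e) chart \<Rightarrow> bool" where
  "smooth_compatible C D \<longleftrightarrow>
     smooth_on (chart_map C ` (chart_dom C \<inter> chart_dom D)) (transition C D) \<and>
     smooth_on (chart_map D ` (chart_dom C \<inter> chart_dom D)) (transition D C)"

definition smooth_atlas :: "('a::topological_space, 'e::euclidean_space) chart set \<Rightarrow> bool" where
  "smooth_atlas A \<longleftrightarrow> (\<forall>C\<in>A. is_chart C) \<and> (\<Union>C\<in>A. chart_dom C) = UNIV \<and>
     (\<forall>C\<in>A. \<forall>D\<in>A. smooth_compatible C D)"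

text \<open>The maximal atlas determined by \<open>A\<close>.\<close>

definition smooth_charts ::
    "('a::topological_space, 'e::euclidean_space) chart set \<Rightarrow> ('a, 'e) chart set" where
  "smooth_charts A = {C. is_chart C \<and> (\<forall>D\<in>A. smooth_compatible C D)}"

text \<open>\<open>g C x v w\<close> is the inner product at \<open>x\<close> of the two tangent vectors with coordinates
  \<open>v\<close> and \<open>w\<close> in the chart \<open>C\<close>; coordinates change by the derivative of the transition map.\<close>

definition riemannian_metric ::
    "('a::topological_space, 'e::euclidean_space) chart set \<Rightarrow>
     (('a, 'e) chart \<Rightarrow> 'a \<Rightarrow> 'e \<Rightarrow> 'e \<Rightarrow> real) \<Rightarrow> bool" where
  "riemannian_metric A g \<longleftrightarrow>
     (\<forall>C\<in>A. \<forall>x\<in>chart_dom C. bilinear (g C x) \<and> (\<forall>v w. g C x v w = g C x w v) \<and>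
        (\<forall>v. v \<noteq> 0 \<longrightarrow> g C x v v > 0)) \<and>
     (\<forall>C\<in>A. \<forall>v w. smooth_on (chart_img C) (\<lambda>p. g C (chart_inv C p) v w)) \<and>
     (\<forall>C\<in>A. \<forall>D\<in>A. \<forall>x\<in>chart_dom C \<inter> chart_dom D. \<forall>v w.
        let d = frechet_derivative (transition C D) (at (chart_map C x))
        in g C x v w = g D x (d v) (d w))"

definition connected_riemannian_manifold ::
    "('a::{t2_space, second_countable_topology}, 'e::euclidean_space) chart set \<Rightarrow>
     (('a, 'e) chart \<Rightarrow> 'a \<Rightarrow> 'e \<Rightarrow> 'e \<Rightarrow> real) \<Rightarrow> bool" where
  "connected_riemannian_manifold A g \<longleftrightarrow>
     smooth_atlas A \<and> riemannian_metric A g \<and> connected (UNIV :: 'a set)"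

text \<open>Concavity is concavity of the coordinate representation; \<open>concave_on\<close> includes
  convexity of the image of the chart.\<close>

definition locally_semiconcave ::
    "('a::topological_space, 'e::euclidean_space) chart set \<Rightarrow> ('a \<Rightarrow> real) \<Rightarrow> bool" where
  "locally_semiconcave A f \<longleftrightarrow> (\<forall>x. \<exists>C\<in>smooth_charts A. x \<in> chart_dom C \<and>
     (\<exists>G H. concave_on (chart_img C) G \<and> smooth_on (chart_img C) H \<and>
        (\<forall>y\<in>chart_dom C. f y = G (chart_map C y) + H (chart_map C y))))"

definition locally_C11 ::
    "('a::topological_space, 'e::euclidean_space) chart set \<Rightarrow> ('a \<Rightarrow> real) \<Rightarrow> bool" where
  "locally_C11 A f \<longleftrightarrow> (\<forall>C\<in>smooth_charts A. C11_on (chart_img C) (f \<circ> chart_inv C))"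

definition subsolution :: "('a \<Rightarrow> 'a \<Rightarrow> real) \<Rightarrow> ('a \<Rightarrow> real) \<Rightarrow> bool" where
  "subsolution c u \<longleftrightarrow> (\<forall>x y. u y - u x \<le> c x y)"

text \<open>\<open>INF\<close> and \<open>SUP\<close> of a real family are unspecified if it is unbounded; for a
  subsolution \<open>u\<close> both families are bounded (by \<open>u x\<close>) on the relevant side.\<close>

definition lax_oleinik_minus :: "('a \<Rightarrow> 'a \<Rightarrow> real) \<Rightarrow> ('a \<Rightarrow> real) \<Rightarrow> 'a \<Rightarrow> real" where
  "lax_oleinik_minus c u x = (INF y. u y + c y x)"

definition lax_oleinik_plus :: "('a \<Rightarrow> 'a \<Rightarrow> real) \<Rightarrow> ('a \<Rightarrow> real) \<Rightarrow> 'a \<Rightarrow> real" where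
  "lax_oleinik_plus c u x = (SUP y. u y - c x y)"

definition whitney_basic :: "('a::topological_space \<Rightarrow> real) \<Rightarrow> ('a \<Rightarrow> real) \<Rightarrow> ('a \<Rightarrow> real) set" where
  "whitney_basic \<epsilon> f = {h. continuous_on UNIV h \<and> (\<forall>x. \<bar>f x - h x\<bar> < \<epsilon> x)}"

text \<open>The carrier of this topology is the set of continuous functions, and the generating sets
  form a basis.\<close>

definition whitney_topology :: "('a::topological_space \<Rightarrow> real) topology" where
  "whitney_topology = topology_generated_by
     {whitney_basic \<epsilon> f |\<epsilon> f. continuous_on UNIV f \<and> continuous_on UNIV \<epsilon> \<and> (\<forall>x. 0 < \<epsilon> x)}"

definition dense_subset :: "'b topology \<Rightarrow> 'b set \<Rightarrow> 'b set \<Rightarrow> bool" where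
  "dense_subset X D S \<longleftrightarrow> D \<subseteq> S \<and> S \<subseteq> X closure_of D"

end

theory Submission
  imports Defs
begin

text \<open>
The proof rests on two facts.

First, there is room around a subsolution \<open>u\<close>: every function \<open>v\<close> with
\<open>u \<le> v \<le> lax_oleinik_minus c u\<close> is again a subsolution, and so is every function \<open>h\<close> with
\<open>lax_oleinik_plus c v \<le> h \<le> v\<close>, for a subsolution \<open>v\<close>
(\<open>subsolution_between_minus\<close>, \<open>subsolution_between_plus\<close>).

Second, the insertion theorem of Ilmanen (\<open>Ilmanen_insertion\<close>): between a locally semiconvex function
\<open>f\<close> and a locally semiconcave function \<open>g \<ge> f\<close> there is a locally \<open>C\<^sup>1\<^sup>,\<^sup>1\<close> function.

Given a continuous subsolution \<open>u\<close> and a width \<open>\<epsilon>\<close>, choose \<open>C\<^sup>1\<^sup>,\<^sup>1\<close> functions \<open>a \<le> u \<le> b\<close> within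
\<open>\<epsilon> / 2\<close> of \<open>u\<close>. Then \<open>v = min (lax_oleinik_minus c u) b\<close> is a semiconcave subsolution,
\<open>f = max (lax_oleinik_plus c v) a\<close> is semiconvex, and \<open>f \<le> v\<close>. Any \<open>C\<^sup>1\<^sup>,\<^sup>1\<close> function between \<open>f\<close> and
\<open>v\<close> is a subsolution within \<open>\<epsilon>\<close> of \<open>u\<close> (\<open>C11_subsolution_near\<close>). The truncations by \<open>a\<close> and \<open>b\<close> are
essential, since the Lax-Oleinik operators may move \<open>u\<close> far away.

The insertion theorem is local, because solutions can be glued by a partition of unity
(\<open>C11_selection\<close>). In a chart, add a large quadratic function to both \<open>f\<close> and \<open>g\<close>. This makes \<open>f\<close>
convex, so the convex envelope of \<open>g\<close> lies between the two; and the convex envelope of a function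
that has touching paraboloids of a fixed opening from above is \<open>C\<^sup>1\<^sup>,\<^sup>1\<close>
(\<open>C11_at_convex_envelope\<close>, \<open>C11_insertion_at\<close>).

Both regularity classes are handled through touching paraboloids in coordinates: a function is
semiconcave iff paraboloids touch its graph from above, and \<open>C\<^sup>1\<^sup>,\<^sup>1\<close> iff they touch from above and
from below. These conditions do not depend on the chart.
\<close>

section \<open>Quadratic supports: semiconcave and C11 functions at a point\<close>
text \<open>A function is semiconcave near a point iff it has, at every nearby \<open>y\<close>, a paraboloid of fixed
opening \<open>M\<close> touching its graph from above, with slope \<open>p y\<close>. In this form semiconcavity survives
changes of coordinates and minima. The bounds on \<open>F\<close> and on the slopes control the error terms
in compositions.\<close>
definition semiconcave_with ::
    "'e::real_normed_vector set \<Rightarrow> real \<Rightarrow> ('e \<Rightarrow> 'e \<Rightarrow>\<^sub>L real) \<Rightarrow> ('e \<Rightarrow> real) \<Rightarrow> bool" where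
  "semiconcave_with S M p F \<longleftrightarrow> (\<forall>y\<in>S. \<bar>F y\<bar> \<le> M \<and> norm (p y) \<le> M \<and>
     (\<forall>z\<in>S. F z \<le> F y + p y (z - y) + M * (norm (z - y))\<^sup>2))"

definition semiconcave_at :: "('e::real_normed_vector \<Rightarrow> real) \<Rightarrow> 'e \<Rightarrow> bool" where
  "semiconcave_at F x \<longleftrightarrow> (\<exists>r>0. \<exists>M p. semiconcave_with (ball x r) M p F)"

text \<open>The two-sided version: a first order expansion with quadratic error whose constant is uniform in
the base point. The uniformity forces \<open>p\<close> to be Lipschitz.\<close>
definition C11_with ::
    "'e::real_normed_vector set \<Rightarrow> real \<Rightarrow> ('e \<Rightarrow> 'e \<Rightarrow>\<^sub>L 'f::real_normed_vector) \<Rightarrow> ('e \<Rightarrow> 'f) \<Rightarrow> bool"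
  where
  "C11_with S M p F \<longleftrightarrow> (\<forall>y\<in>S. norm (F y) \<le> M \<and> norm (p y) \<le> M \<and>
     (\<forall>z\<in>S. norm (F z - F y - p y (z - y)) \<le> M * (norm (z - y))\<^sup>2))"

definition C11_at :: "('e::real_normed_vector \<Rightarrow> 'f::real_normed_vector) \<Rightarrow> 'e \<Rightarrow> bool" where
  "C11_at F x \<longleftrightarrow> (\<exists>r>0. \<exists>M p. C11_with (ball x r) M p F)"

lemma semiconcave_with_mono:
  assumes "semiconcave_with S M p F" "T \<subseteq> S" "M \<le> N"
  shows "semiconcave_with T N p F"
proof -
  have "M * (norm (z - y))\<^sup>2 \<le> N * (norm (z - y))\<^sup>2" for y z :: 'a
    using assms(3) by (simp add: mult_right_mono)
  then show ?thesis
    using assms unfolding semiconcave_with_def by (meson add_left_mono order_trans subsetD)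
qed

lemma C11_with_mono:
  assumes "C11_with S M p F" "T \<subseteq> S" "M \<le> N"
  shows "C11_with T N p F"
proof -
  have "M * (norm (z - y))\<^sup>2 \<le> N * (norm (z - y))\<^sup>2" for y z :: 'a
    using assms(3) by (simp add: mult_right_mono)
  then show ?thesis
    using assms unfolding C11_with_def by (meson order_trans subsetD)
qed

lemma semiconcave_with_nonneg: "semiconcave_with S M p F \<Longrightarrow> S \<noteq> {} \<Longrightarrow> 0 \<le> M"
  unfolding semiconcave_with_def by (meson abs_ge_zero equals0I order_trans)

lemma C11_with_nonneg: "C11_with S M p F \<Longrightarrow> S \<noteq> {} \<Longrightarrow> 0 \<le> M"
  unfolding C11_with_def by (meson norm_ge_zero equals0I order_trans)

lemma semiconcave_at_pair:
  assumes "semiconcave_at F x" "semiconcave_at G x"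
  obtains r M p q where "r > 0" "M \<ge> 0"
    "semiconcave_with (ball x r) M p F" "semiconcave_with (ball x r) M q G"
proof -
  obtain r1 M1 p where 1: "r1 > 0" "semiconcave_with (ball x r1) M1 p F"
    using assms(1) semiconcave_at_def by blast
  obtain r2 M2 q where 2: "r2 > 0" "semiconcave_with (ball x r2) M2 q G"
    using assms(2) semiconcave_at_def by blast
  have "M1 \<ge> 0"
    using semiconcave_with_nonneg[OF 1(2)] 1(1) by simp
  then show ?thesis
    using that[of "min r1 r2" "max M1 M2" p q] 1 2
      semiconcave_with_mono[OF 1(2), of "ball x (min r1 r2)" "max M1 M2"]
      semiconcave_with_mono[OF 2(2), of "ball x (min r1 r2)" "max M1 M2"] by force
qed

lemma C11_at_pair:
  assumes "C11_at F x" "C11_at G x"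
  obtains r M p q where "r > 0" "M \<ge> 0"
    "C11_with (ball x r) M p F" "C11_with (ball x r) M q G"
proof -
  obtain r1 M1 p where 1: "r1 > 0" "C11_with (ball x r1) M1 p F"
    using assms(1) C11_at_def by blast
  obtain r2 M2 q where 2: "r2 > 0" "C11_with (ball x r2) M2 q G"
    using assms(2) C11_at_def by blast
  have "M1 \<ge> 0"
    using C11_with_nonneg[OF 1(2)] 1(1) by simp
  then show ?thesis
    using that[of "min r1 r2" "max M1 M2" p q] 1 2
      C11_with_mono[OF 1(2), of "ball x (min r1 r2)" "max M1 M2"]
      C11_with_mono[OF 2(2), of "ball x (min r1 r2)" "max M1 M2"] by force
qed

lemma semiconcave_at_cong:
  assumes "open S" "x \<in> S" "\<And>y. y \<in> S \<Longrightarrow> F y = G y" "semiconcave_at F x"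
  shows "semiconcave_at G x"
proof -
  obtain r M p where r: "r > 0" "semiconcave_with (ball x r) M p F"
    using assms(4) semiconcave_at_def by blast
  obtain e where e: "e > 0" "ball x e \<subseteq> S"
    using assms(1,2) open_contains_ball by blast
  have "semiconcave_with (ball x (min r e)) M p F"
    by (rule semiconcave_with_mono[OF r(2)]) auto
  moreover have "F y = G y" if "y \<in> ball x (min r e)" for y
    using that e(2) assms(3) by auto
  ultimately have "semiconcave_with (ball x (min r e)) M p G"
    unfolding semiconcave_with_def by metis
  then show ?thesis
    unfolding semiconcave_at_def using r(1) e(1) by (metis min_less_iff_conj)
qed

lemma semiconcave_at_add:
  assumes "semiconcave_at F x" "semiconcave_at G x"
  shows "semiconcave_at (\<lambda>y. F y + G y) x"
proof -
  obtain r M p q where r: "r > 0" "M \<ge> 0"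
    and F: "semiconcave_with (ball x r) M p F" and G: "semiconcave_with (ball x r) M q G"
    using semiconcave_at_pair assms by blast
  have "semiconcave_with (ball x r) (2 * M) (\<lambda>y. p y + q y) (\<lambda>y. F y + G y)"
    unfolding semiconcave_with_def
  proof (intro ballI conjI)
    fix y assume y: "y \<in> ball x r"
    have 1: "\<bar>F y\<bar> \<le> M" "norm (p y) \<le> M" "\<bar>G y\<bar> \<le> M" "norm (q y) \<le> M"
      using F G y by (auto simp: semiconcave_with_def)
    show "\<bar>F y + G y\<bar> \<le> 2 * M" using 1 by linarith
    show "norm (p y + q y) \<le> 2 * M" using 1 norm_triangle_ineq[of "p y" "q y"] by linarith
    fix z assume z: "z \<in> ball x r"
    have "F z \<le> F y + p y (z - y) + M * (norm (z - y))\<^sup>2"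
      "G z \<le> G y + q y (z - y) + M * (norm (z - y))\<^sup>2"
      using F G y z by (auto simp: semiconcave_with_def)
    then show "F z + G z \<le> F y + G y + (p y + q y) (z - y) + 2 * M * (norm (z - y))\<^sup>2"
      by (simp add: plus_blinfun.rep_eq)
  qed
  then show ?thesis using r(1) semiconcave_at_def by blast
qed

lemma semiconcave_at_min:
  assumes "semiconcave_at F x" "semiconcave_at G x"
  shows "semiconcave_at (\<lambda>y. min (F y) (G y)) x"
proof -
  obtain r M p q where r: "r > 0" "M \<ge> 0"
    and F: "semiconcave_with (ball x r) M p F" and G: "semiconcave_with (ball x r) M q G"
    using semiconcave_at_pair assms by blast
  have "semiconcave_with (ball x r) M (\<lambda>y. if F y \<le> G y then p y else q y) (\<lambda>y. min (F y) (G y))"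
    unfolding semiconcave_with_def
  proof (intro ballI conjI)
    fix y assume y: "y \<in> ball x r"
    have 1: "\<bar>F y\<bar> \<le> M" "norm (p y) \<le> M" "\<bar>G y\<bar> \<le> M" "norm (q y) \<le> M"
      using F G y by (auto simp: semiconcave_with_def)
    show "\<bar>min (F y) (G y)\<bar> \<le> M" using 1 by linarith
    show "norm (if F y \<le> G y then p y else q y) \<le> M" using 1 by simp
    fix z assume z: "z \<in> ball x r"
    have "F z \<le> F y + p y (z - y) + M * (norm (z - y))\<^sup>2"
      "G z \<le> G y + q y (z - y) + M * (norm (z - y))\<^sup>2"
      using F G y z by (auto simp: semiconcave_with_def)
    then show "min (F z) (G z) \<le> min (F y) (G y) + (if F y \<le> G y then p y else q y) (z - y)
        + M * (norm (z - y))\<^sup>2"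
      by auto
  qed
  then show ?thesis using r(1) semiconcave_at_def by blast
qed

lemma C11_with_lipschitz:
  assumes "C11_with (ball x r) M p F" "y \<in> ball x r" "z \<in> ball x r"
  shows "norm (F z - F y) \<le> (M + M * (2 * r)) * norm (z - y)"
proof -
  have M: "M \<ge> 0" using C11_with_nonneg assms by blast
  have b: "norm (p y) \<le> M" "norm (F z - F y - p y (z - y)) \<le> M * (norm (z - y))\<^sup>2"
    using assms by (auto simp: C11_with_def)
  have "norm (z - y) \<le> norm (z - x) + norm (x - y)"
    using norm_triangle_ineq[of "z - x" "x - y"] by simp
  then have d: "norm (z - y) \<le> 2 * r"
    using assms(2,3) by (simp add: dist_norm norm_minus_commute)
  have "norm (p y (z - y)) \<le> M * norm (z - y)"
    using norm_blinfun[of "p y" "z - y"] b(1) mult_right_mono[of _ M "norm (z - y)"]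
    by (smt (verit) norm_ge_zero)
  moreover have "M * (norm (z - y))\<^sup>2 \<le> M * (2 * r) * norm (z - y)"
    unfolding power2_eq_square using M d
    by (metis mult.assoc mult_left_mono mult_right_mono norm_ge_zero)
  moreover have "norm (F z - F y) \<le> norm (F z - F y - p y (z - y)) + norm (p y (z - y))"
    using norm_triangle_ineq[of "F z - F y - p y (z - y)" "p y (z - y)"] by simp
  ultimately show ?thesis using b(2) by (simp add: algebra_simps)
qed

text \<open>Composing a touching paraboloid with \<open>\<psi>\<close> gives a touching function whose deviation from its
linearisation is quadratic: one contribution comes from the expansion of \<open>\<psi>\<close>, fed into the
bounded slope of \<open>F\<close>, the other from the Lipschitz bound on \<open>\<psi>\<close>, fed into the quadratic term.\<close>
lemma semiconcave_at_compose:
  assumes F: "semiconcave_at F (\<psi> x)" and \<psi>: "C11_at \<psi> x"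
  shows "semiconcave_at (\<lambda>y. F (\<psi> y)) x"
proof -
  obtain r1 M1 p where r1: "r1 > 0" and F: "semiconcave_with (ball (\<psi> x) r1) M1 p F"
    using F semiconcave_at_def by blast
  obtain r2 M2 P where r2: "r2 > 0" and \<psi>: "C11_with (ball x r2) M2 P \<psi>"
    using \<psi> C11_at_def by blast
  define L where "L = M2 + M2 * (2 * r2)"
  have M: "0 \<le> M1" "0 \<le> M2"
    using semiconcave_with_nonneg[OF F] C11_with_nonneg[OF \<psi>] r1 r2 by auto
  then have L: "L \<ge> 0" unfolding L_def using r2 by simp
  \<comment> \<open>The radius is chosen so that \<open>\<psi>\<close>, being
    \<open>L\<close>-Lipschitz, maps the ball into \<open>ball (\<psi> x) r1\<close>.\<close>
  define r where "r = min r2 (r1 / (L + 1))"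
  have r: "r > 0" using r1 r2 L by (simp add: r_def)
  have lip: "norm (\<psi> z - \<psi> y) \<le> L * norm (z - y)" if "y \<in> ball x r" "z \<in> ball x r" for y z
    using C11_with_lipschitz[OF \<psi>] that unfolding L_def r_def by auto
  have img: "\<psi> y \<in> ball (\<psi> x) r1" if y: "y \<in> ball x r" for y
  proof -
    have "norm (\<psi> y - \<psi> x) \<le> L * norm (y - x)" using lip[of x y] y r by simp
    also have "\<dots> \<le> L * (r1 / (L + 1))"
      using y L unfolding r_def by (intro mult_left_mono) (auto simp: dist_norm norm_minus_commute)
    also have "\<dots> < r1" using r1 L by (simp add: field_simps)
    finally show ?thesis by (simp add: dist_norm norm_minus_commute)
  qed
  have "semiconcave_with (ball x r) (M1 + M1 * M2 + M1 * L\<^sup>2) (\<lambda>y. p (\<psi> y) o\<^sub>L P y) (\<lambda>y. F (\<psi> y))"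
    unfolding semiconcave_with_def
  proof (intro ballI conjI)
    fix y assume y: "y \<in> ball x r"
    then have y2: "y \<in> ball x r2" by (simp add: r_def)
    have b: "\<bar>F (\<psi> y)\<bar> \<le> M1" "norm (p (\<psi> y)) \<le> M1" "norm (P y) \<le> M2"
      using F \<psi> img[OF y] y2 by (auto simp: semiconcave_with_def C11_with_def)
    have nn: "0 \<le> M1 * M2" "0 \<le> M1 * L\<^sup>2" using M by auto
    show "\<bar>F (\<psi> y)\<bar> \<le> M1 + M1 * M2 + M1 * L\<^sup>2" using b nn by linarith
    have "norm (p (\<psi> y) o\<^sub>L P y) \<le> norm (p (\<psi> y)) * norm (P y)" by (rule norm_blinfun_compose)
    also have "\<dots> \<le> M1 * M2" using b M by (intro mult_mono) auto
    finally show "norm (p (\<psi> y) o\<^sub>L P y) \<le> M1 + M1 * M2 + M1 * L\<^sup>2" using nn M by linarith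
    fix z assume z: "z \<in> ball x r"
    then have z2: "z \<in> ball x r2" by (simp add: r_def)
    let ?d = "norm (z - y)"
    have 1: "F (\<psi> z) \<le> F (\<psi> y) + p (\<psi> y) (\<psi> z - \<psi> y) + M1 * (norm (\<psi> z - \<psi> y))\<^sup>2"
      using F img[OF y] img[OF z] by (auto simp: semiconcave_with_def)
    have 2: "M1 * (norm (\<psi> z - \<psi> y))\<^sup>2 \<le> M1 * L\<^sup>2 * ?d\<^sup>2"
      using power_mono[OF lip[OF y z], of 2] M
      by (simp add: power_mult_distrib mult_left_mono mult.assoc)
    have e: "norm (\<psi> z - \<psi> y - P y (z - y)) \<le> M2 * ?d\<^sup>2"
      using \<psi> y2 z2 by (auto simp: C11_with_def)
    have "norm (p (\<psi> y) (\<psi> z - \<psi> y - P y (z - y))) \<le> norm (p (\<psi> y)) * norm (\<psi> z - \<psi> y - P y (z - y))"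
      by (rule norm_blinfun)
    also have "\<dots> \<le> M1 * (M2 * ?d\<^sup>2)" using e b M by (intro mult_mono) auto
    finally have "p (\<psi> y) (\<psi> z - \<psi> y) \<le> p (\<psi> y) (P y (z - y)) + M1 * M2 * ?d\<^sup>2"
      by (simp add: blinfun.diff_right abs_le_iff)
    moreover have "0 \<le> M1 * ?d\<^sup>2" using M by simp
    ultimately show "F (\<psi> z) \<le> F (\<psi> y) + (p (\<psi> y) o\<^sub>L P y) (z - y) + (M1 + M1 * M2 + M1 * L\<^sup>2) * ?d\<^sup>2"
      using 1 2 by (simp add: distrib_right)
  qed
  then show ?thesis using r semiconcave_at_def by blast
qed

lemma C11_at_imp_semiconcave_at:
  assumes "C11_at F x"
  shows "semiconcave_at F x" "semiconcave_at (\<lambda>y. - F y) x"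
proof -
  obtain r M p where r: "r > 0" and F: "C11_with (ball x r) M p F"
    using assms C11_at_def by blast
  have b: "\<bar>F z - F y - p y (z - y)\<bar> \<le> M * (norm (z - y))\<^sup>2"
    if "y \<in> ball x r" "z \<in> ball x r" for y z
    using F that by (simp add: C11_with_def)
  have n: "\<bar>F y\<bar> \<le> M \<and> norm (p y) \<le> M" if "y \<in> ball x r" for y
    using F that by (simp add: C11_with_def)
  have "F z \<le> F y + p y (z - y) + M * (norm (z - y))\<^sup>2"
    if "y \<in> ball x r" "z \<in> ball x r" for y z
    using b[OF that] by linarith
  then have "semiconcave_with (ball x r) M p F"
    unfolding semiconcave_with_def using n by blast
  then show "semiconcave_at F x" using r semiconcave_at_def by blast
  have "- F z \<le> - F y + (- p y) (z - y) + M * (norm (z - y))\<^sup>2"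
    if "y \<in> ball x r" "z \<in> ball x r" for y z
    using b[OF that] by (simp add: uminus_blinfun.rep_eq)
  then have "semiconcave_with (ball x r) M (\<lambda>y. - p y) (\<lambda>y. - F y)"
    unfolding semiconcave_with_def norm_minus_cancel abs_minus_cancel using n by blast
  then show "semiconcave_at (\<lambda>y. - F y) x" using r semiconcave_at_def by blast
qed

lemma linear_zero_of_quadratic_bound:
  fixes l :: "'e::real_normed_vector \<Rightarrow>\<^sub>L real"
  assumes "e > 0" and bound: "\<And>d. norm d < e \<Longrightarrow> l d \<le> K * (norm d)\<^sup>2"
  shows "l = 0"
proof (rule ccontr)
  assume "l \<noteq> 0"
  then obtain v0 where "l v0 \<noteq> 0" by (metis blinfun_eqI zero_blinfun.rep_eq)
  then obtain v where v: "l v > 0" by (metis blinfun.minus_right neg_0_less_iff_less linorder_neqE)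
  have "v \<noteq> 0" using v by auto
  have "((\<lambda>t. K * t * (norm v)\<^sup>2) \<longlongrightarrow> K * 0 * (norm v)\<^sup>2) (at_right 0)"
    by (intro tendsto_intros)
  then have "\<forall>\<^sub>F t in at_right 0. K * t * (norm v)\<^sup>2 < l v"
    using v by (intro order_tendstoD) auto
  moreover have "\<forall>\<^sub>F t in at_right 0. t < e / norm v"
    using assms(1) \<open>v \<noteq> 0\<close> by (intro eventually_at_right_less order_tendstoD(2)[OF tendsto_ident_at]) auto
  moreover have "\<forall>\<^sub>F t::real in at_right 0. 0 < t" by (rule eventually_at_right_less)
  ultimately have "\<forall>\<^sub>F t in at_right 0. K * t * (norm v)\<^sup>2 < l v \<and> t < e / norm v \<and> 0 < t"
    by eventually_elim auto
  then obtain t where t: "K * t * (norm v)\<^sup>2 < l v" "t < e / norm v" "0 < t"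
    using eventually_happens trivial_limit_at_right_real by blast
  have "norm (t *\<^sub>R v) < e" using t \<open>v \<noteq> 0\<close> by (simp add: field_simps)
  from bound[OF this] have "t * l v \<le> t * (K * t * (norm v)\<^sup>2)"
    by (simp add: blinfun.scaleR_right power2_eq_square power_mult_distrib algebra_simps)
  then show False using t by simp
qed

text \<open>Semiconcave together with semiconvex is the same as \<open>C\<^sup>1\<^sup>,\<^sup>1\<close>: at each \<open>y\<close> the paraboloids
touching from above and from below also touch each other, hence have the same slope. The closure
properties of \<open>C\<^sup>1\<^sup>,\<^sup>1\<close> functions under sums and compositions are thereby inherited from those of
semiconcave functions.\<close>
lemma C11_at_iff_semiconcave:
  fixes F :: "'e::real_normed_vector \<Rightarrow> real"
  shows "C11_at F x \<longleftrightarrow> semiconcave_at F x \<and> semiconcave_at (\<lambda>y. - F y) x"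
proof (intro iffI conjI)
  assume asm: "semiconcave_at F x \<and> semiconcave_at (\<lambda>y. - F y) x"
  then obtain r M p q where r: "r > 0" "M \<ge> 0"
    and F: "semiconcave_with (ball x r) M p F"
    and G: "semiconcave_with (ball x r) M q (\<lambda>y. - F y)"
    using semiconcave_at_pair by metis
  have "C11_with (ball x r) M p F"
    unfolding C11_with_def
  proof (intro ballI conjI)
    fix y assume y: "y \<in> ball x r"
    show "norm (F y) \<le> M" "norm (p y) \<le> M"
      using F y by (auto simp: semiconcave_with_def)
    have up: "F z \<le> F y + p y (z - y) + M * (norm (z - y))\<^sup>2" if "z \<in> ball x r" for z
      using F y that by (auto simp: semiconcave_with_def)
    have lo: "F y - q y (z - y) - M * (norm (z - y))\<^sup>2 \<le> F z" if "z \<in> ball x r" for z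
      using G y that by (force simp: semiconcave_with_def)
    obtain e where e: "e > 0" "ball y e \<subseteq> ball x r"
      using y open_contains_ball open_ball by blast
    \<comment> \<open>The upper paraboloid lies above the lower one.\<close>
    have "(- q y - p y) d \<le> (2 * M) * (norm d)\<^sup>2" if "norm d < e" for d
      using that e up[of "y + d"] lo[of "y + d"]
      by (force simp: minus_blinfun.rep_eq uminus_blinfun.rep_eq dist_norm subset_iff)
    from linear_zero_of_quadratic_bound[OF e(1) this] have pq: "- q y = p y" by simp
    have "- q y (z - y) = p y (z - y)" for z
      by (metis pq uminus_blinfun.rep_eq)
    moreover fix z assume z: "z \<in> ball x r"
    ultimately have "- q y (z - y) = p y (z - y)" by blast
    then show "norm (F z - F y - p y (z - y)) \<le> M * (norm (z - y))\<^sup>2"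
      using up[OF z] lo[OF z] unfolding real_norm_def abs_le_iff by linarith
  qed
  then show "C11_at F x" using r C11_at_def by blast
qed (auto dest: C11_at_imp_semiconcave_at)

lemma C11_at_mult:
  fixes F G :: "'e::real_normed_vector \<Rightarrow> real"
  assumes "C11_at F x" "C11_at G x"
  shows "C11_at (\<lambda>y. F y * G y) x"
proof -
  obtain r M p q where r: "r > 0" "M \<ge> 0"
    and F: "C11_with (ball x r) M p F" and G: "C11_with (ball x r) M q G"
    using C11_at_pair assms by blast
  define L where "L = M + M * (2 * r)"
  have "C11_with (ball x r) (2 * M\<^sup>2 + L\<^sup>2) (\<lambda>y. F y *\<^sub>R q y + G y *\<^sub>R p y) (\<lambda>y. F y * G y)"
    unfolding C11_with_def
  proof (intro ballI conjI)
    fix y assume y: "y \<in> ball x r"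
    have b: "\<bar>F y\<bar> \<le> M" "norm (p y) \<le> M" "\<bar>G y\<bar> \<le> M" "norm (q y) \<le> M"
      using F G y by (auto simp: C11_with_def)
    have m: "\<bar>F y\<bar> * \<bar>G y\<bar> \<le> M * M" "\<bar>F y\<bar> * norm (q y) \<le> M * M" "\<bar>G y\<bar> * norm (p y) \<le> M * M"
      using b r by (auto intro!: mult_mono)
    have L2: "0 \<le> L\<^sup>2" and M2: "0 \<le> M * M" by simp_all
    show "norm (F y * G y) \<le> 2 * M\<^sup>2 + L\<^sup>2"
      using m(1) L2 M2 unfolding real_norm_def abs_mult power2_eq_square[of M] by linarith
    have "norm (F y *\<^sub>R q y + G y *\<^sub>R p y) \<le> \<bar>F y\<bar> * norm (q y) + \<bar>G y\<bar> * norm (p y)"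
      by (metis norm_scaleR norm_triangle_ineq)
    then show "norm (F y *\<^sub>R q y + G y *\<^sub>R p y) \<le> 2 * M\<^sup>2 + L\<^sup>2"
      using m L2 unfolding power2_eq_square[of M] by linarith
    fix z assume z: "z \<in> ball x r"
    let ?d = "norm (z - y)"
    have e: "\<bar>F z - F y - p y (z - y)\<bar> \<le> M * ?d\<^sup>2" "\<bar>G z - G y - q y (z - y)\<bar> \<le> M * ?d\<^sup>2"
      using F G y z by (auto simp: C11_with_def)
    have l: "\<bar>F z - F y\<bar> \<le> L * ?d" "\<bar>G z - G y\<bar> \<le> L * ?d"
      using C11_with_lipschitz[OF F y z] C11_with_lipschitz[OF G y z] by (auto simp: L_def)
    have eq: "F z * G z - F y * G y - (F y *\<^sub>R q y + G y *\<^sub>R p y) (z - y)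
        = F y * (G z - G y - q y (z - y)) + G y * (F z - F y - p y (z - y))
          + (F z - F y) * (G z - G y)"
      by (simp add: plus_blinfun.rep_eq scaleR_blinfun.rep_eq algebra_simps)
    have 1: "\<bar>F y * (G z - G y - q y (z - y))\<bar> \<le> M * (M * ?d\<^sup>2)"
      "\<bar>G y * (F z - F y - p y (z - y))\<bar> \<le> M * (M * ?d\<^sup>2)"
      "\<bar>(F z - F y) * (G z - G y)\<bar> \<le> (L * ?d) * (L * ?d)"
      unfolding abs_mult using e l b r by (auto intro!: mult_mono)
    then have "\<bar>F z * G z - F y * G y - (F y *\<^sub>R q y + G y *\<^sub>R p y) (z - y)\<bar>
        \<le> M * (M * ?d\<^sup>2) + M * (M * ?d\<^sup>2) + (L * ?d) * (L * ?d)"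
      unfolding eq by linarith
    also have "\<dots> = (2 * M\<^sup>2 + L\<^sup>2) * ?d\<^sup>2" by (simp add: power2_eq_square algebra_simps)
    finally show "norm (F z * G z - F y * G y - (F y *\<^sub>R q y + G y *\<^sub>R p y) (z - y))
        \<le> (2 * M\<^sup>2 + L\<^sup>2) * ?d\<^sup>2" by simp
  qed
  then show ?thesis using r C11_at_def by blast
qed

section \<open>Lipschitz derivatives, smooth functions and concave functions\<close>
lemma C11_at_of_lipschitz_derivative:
  fixes F :: "'e::real_normed_vector \<Rightarrow> 'f::real_normed_vector"
  assumes "r > 0"
    and der: "\<And>y. y \<in> ball x r \<Longrightarrow> (F has_derivative blinfun_apply (P y)) (at y)"
    and lip: "\<And>y z. y \<in> ball x r \<Longrightarrow> z \<in> ball x r \<Longrightarrow> norm (P z - P y) \<le> K * norm (z - y)"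
  shows "C11_at F x"
proof -
  define L where "L = max K 0"
  have L: "L \<ge> 0" by (simp add: L_def)
  have lip: "norm (P z - P y) \<le> L * norm (z - y)" if "y \<in> ball x r" "z \<in> ball x r" for y z
    using lip[OF that] mult_right_mono[of K L "norm (z - y)"] by (simp add: L_def)
  have quad: "norm (F z - F y - P y (z - y)) \<le> L * (norm (z - y))\<^sup>2"
    if y: "y \<in> ball x r" and z: "z \<in> ball x r" for y z
  proof -
    have seg: "closed_segment y z \<subseteq> ball x r"
      using y z by (simp add: closed_segment_subset)
    have "norm (F z - F y - P y (z - y)) \<le> norm (z - y) * (L * norm (z - y))"
    proof (rule differentiable_bound_linearization[where S = "closed_segment y z" and f' = "\<lambda>w. blinfun_apply (P w)"])
      show "y + t *\<^sub>R (z - y) \<in> closed_segment y z" if "t \<in> {0..1}" for t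
        using that by (auto simp: closed_segment_def algebra_simps intro!: exI[of _ t])
      show "(F has_derivative blinfun_apply (P w)) (at w within closed_segment y z)"
        if "w \<in> closed_segment y z" for w
        using der seg that has_derivative_at_withinI by blast
      show "onorm (blinfun_apply (P w) - blinfun_apply (P y)) \<le> L * norm (z - y)"
        if w: "w \<in> closed_segment y z" for w
      proof -
        have "onorm (blinfun_apply (P w) - blinfun_apply (P y)) = norm (P w - P y)"
          by (simp add: norm_blinfun.rep_eq minus_blinfun.rep_eq fun_diff_def)
        also have "\<dots> \<le> L * norm (w - y)" using lip y w seg by blast
        also have "\<dots> \<le> L * norm (z - y)"
          using segment_bound(1)[OF w] L by (simp add: mult_left_mono)
        finally show ?thesis .
      qed
      show "y \<in> closed_segment y z" by simp
    qed
    then show ?thesis by (simp add: power2_eq_square algebra_simps)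
  qed
  have x: "x \<in> ball x r" using assms(1) by simp
  define M where "M = max L (max (norm (P x) + L * r) (norm (F x) + norm (P x) * r + L * r\<^sup>2))"
  have "C11_with (ball x r) M P F"
    unfolding C11_with_def
  proof (intro ballI conjI)
    fix y assume y: "y \<in> ball x r"
    have d: "norm (y - x) \<le> r" using y by (simp add: dist_norm norm_minus_commute)
    have "norm (P y) \<le> norm (P x) + norm (P y - P x)"
      using norm_triangle_ineq[of "P x" "P y - P x"] by simp
    also have "\<dots> \<le> norm (P x) + L * r"
      using lip[OF x y] mult_left_mono[OF d L] by linarith
    finally show "norm (P y) \<le> M" unfolding M_def by linarith
    have "norm (F y) \<le> norm (F x) + norm (P x (y - x)) + norm (F y - F x - P x (y - x))"
      using norm_triangle_ineq[of "F x + P x (y - x)" "F y - F x - P x (y - x)"]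
        norm_triangle_ineq[of "F x" "P x (y - x)"] by (simp add: algebra_simps)
    also have "norm (P x (y - x)) \<le> norm (P x) * r"
      using norm_blinfun[of "P x" "y - x"] mult_left_mono[OF d, of "norm (P x)"] by simp
    also have "norm (F y - F x - P x (y - x)) \<le> L * r\<^sup>2"
      using quad[OF x y] mult_left_mono[OF power_mono[OF d, of 2] L] by simp
    finally show "norm (F y) \<le> M" unfolding M_def by linarith
    fix z assume z: "z \<in> ball x r"
    have "L * (norm (z - y))\<^sup>2 \<le> M * (norm (z - y))\<^sup>2"
      by (rule mult_right_mono) (auto simp: M_def)
    then show "norm (F z - F y - P y (z - y)) \<le> M * (norm (z - y))\<^sup>2"
      using quad[OF y z] by linarith
  qed
  then show ?thesis using assms(1) C11_at_def by blast
qed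

lemma C1_locally_lipschitz:
  fixes F :: "'e::euclidean_space \<Rightarrow> 'f::real_normed_vector"
  assumes "Ck_on (Suc 0) S F" "open S" "x \<in> S"
  shows "\<exists>r>0. \<exists>L. \<forall>y\<in>ball x r. \<forall>z\<in>ball x r. norm (F z - F y) \<le> L * norm (z - y)"
proof -
  obtain r where r: "r > 0" "cball x r \<subseteq> S"
    using assms(2,3) open_contains_cball by blast
  have diff: "F differentiable (at y)" if "y \<in> S" for y
    using assms(1) that by simp
  have "\<exists>B. \<forall>y\<in>cball x r. norm (frechet_derivative F (at y) b) \<le> B" for b
  proof -
    have "continuous_on (cball x r) (\<lambda>y. frechet_derivative F (at y) b)"
      using assms(1) r(2) by (auto intro: continuous_on_subset)
    then have "bounded ((\<lambda>y. frechet_derivative F (at y) b) ` cball x r)"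
      by (intro compact_imp_bounded compact_continuous_image) auto
    then show ?thesis by (auto simp: bounded_iff)
  qed
  then obtain B where B: "\<And>b y. y \<in> cball x r \<Longrightarrow> norm (frechet_derivative F (at y) b) \<le> B b"
    by metis
  have "norm (F z - F y) \<le> (\<Sum>b\<in>Basis. B b) * norm (z - y)"
    if "y \<in> ball x r" "z \<in> ball x r" for y z
  proof (rule differentiable_bound[where S = "ball x r"])
    fix w assume "w \<in> ball x r"
    then have w: "w \<in> cball x r" "w \<in> S" using r(2) by auto
    have der: "(F has_derivative frechet_derivative F (at w)) (at w)"
      using diff[OF w(2)] frechet_derivative_works by blast
    then show "(F has_derivative frechet_derivative F (at w)) (at w within ball x r)"
      using has_derivative_at_withinI by blast
    have bl: "bounded_linear (frechet_derivative F (at w))"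
      using der has_derivative_bounded_linear by blast
    have "onorm (frechet_derivative F (at w)) = norm (Blinfun (frechet_derivative F (at w)))"
      using bl by (simp add: norm_blinfun.rep_eq bounded_linear_Blinfun_apply)
    also have "\<dots> \<le> (\<Sum>b\<in>Basis. norm (Blinfun (frechet_derivative F (at w)) b))"
      by (rule norm_blinfun_euclidean_le)
    also have "\<dots> \<le> (\<Sum>b\<in>Basis. B b)"
      using B[OF w(1)] bl by (intro sum_mono) (simp add: bounded_linear_Blinfun_apply)
    finally show "onorm (frechet_derivative F (at w)) \<le> (\<Sum>b\<in>Basis. B b)" .
  qed (use that in auto)
  then show ?thesis using r(1) by blast
qed

text \<open>Only two derivatives matter: the partial derivatives of \<open>F\<close> are \<open>C\<^sup>1\<close>, hence locally Lipschitz,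
and the operator norm of \<open>P z - P y\<close> is at most the sum of the norms on a basis.\<close>
lemma smooth_on_imp_C11_at:
  fixes F :: "'e::euclidean_space \<Rightarrow> 'f::real_normed_vector"
  assumes "smooth_on S F" "open S" "x \<in> S"
  shows "C11_at F x"
proof -
  have "Ck_on (Suc (Suc 0)) S F" using assms(1) smooth_on_def by blast
  then have diff: "\<And>y. y \<in> S \<Longrightarrow> F differentiable (at y)"
    and C1: "\<And>v. Ck_on (Suc 0) S (\<lambda>y. frechet_derivative F (at y) v)" by auto
  obtain r L where r: "\<And>b. r b > 0"
    and L: "\<And>b y z. y \<in> ball x (r b) \<Longrightarrow> z \<in> ball x (r b) \<Longrightarrow>
      norm (frechet_derivative F (at z) b - frechet_derivative F (at y) b) \<le> L b * norm (z - y)"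
    using C1_locally_lipschitz[OF C1 assms(2,3)] by metis
  obtain r0 where r0: "r0 > 0" "ball x r0 \<subseteq> S"
    using assms(2,3) open_contains_ball by blast
  define s where "s = Min (insert r0 (r ` Basis))"
  have s: "s > 0" "ball x s \<subseteq> S" "\<And>b. b \<in> Basis \<Longrightarrow> ball x s \<subseteq> ball x (r b)"
  proof -
    show "s > 0" unfolding s_def using r r0 by (subst Min_gr_iff) auto
    have "s \<le> r0" unfolding s_def by (intro Min_le) auto
    then show "ball x s \<subseteq> S" using r0(2) by auto
    fix b :: 'e assume "b \<in> Basis"
    then have "s \<le> r b" unfolding s_def by (intro Min_le) auto
    then show "ball x s \<subseteq> ball x (r b)" by auto
  qed
  define P where "P y = Blinfun (frechet_derivative F (at y))" for y
  have der: "(F has_derivative frechet_derivative F (at y)) (at y)" if "y \<in> S" for y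
    using diff[OF that] frechet_derivative_works by blast
  have P: "blinfun_apply (P y) = frechet_derivative F (at y)" if "y \<in> S" for y
    unfolding P_def
    by (intro bounded_linear_Blinfun_apply has_derivative_bounded_linear[OF der[OF that]])
  show ?thesis
  proof (rule C11_at_of_lipschitz_derivative[of s x F P "\<Sum>b\<in>Basis. L b"])
    show "s > 0" by (fact s(1))
    fix y assume y: "y \<in> ball x s"
    then show "(F has_derivative blinfun_apply (P y)) (at y)" using der P s(2) by (metis subsetD)
    fix z assume z: "z \<in> ball x s"
    have "norm (P z - P y) \<le> (\<Sum>b\<in>Basis. norm ((P z - P y) b))"
      by (rule norm_blinfun_euclidean_le)
    also have "\<dots> \<le> (\<Sum>b\<in>Basis. L b * norm (z - y))"
    proof (rule sum_mono)
      fix b :: 'e assume b: "b \<in> Basis"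
      have "y \<in> S" "z \<in> S" "y \<in> ball x (r b)" "z \<in> ball x (r b)" using s(2) s(3)[OF b] y z by blast+
      then show "norm ((P z - P y) b) \<le> L b * norm (z - y)"
        using L by (simp add: minus_blinfun.rep_eq P)
    qed
    finally show "norm (P z - P y) \<le> (\<Sum>b\<in>Basis. L b) * norm (z - y)"
      by (simp add: sum_distrib_right)
  qed
qed

lemma C11_with_imp_has_derivative:
  assumes "C11_with (ball x r) M p F" "y \<in> ball x r"
  shows "(F has_derivative blinfun_apply (p y)) (at y)"
proof -
  obtain e where e: "e > 0" "ball y e \<subseteq> ball x r"
    using assms(2) open_contains_ball open_ball by blast
  show ?thesis
  proof (rule has_derivativeI_sandwich[OF e(1)])
    show "((\<lambda>z. M * norm (z - y)) \<longlongrightarrow> 0) (at y)"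
      by (auto intro!: tendsto_eq_intros)
    fix z assume z: "z \<noteq> y" "dist z y < e"
    then have "z \<in> ball x r" using e(2) by (auto simp: dist_commute)
    then have "norm (F z - F y - p y (z - y)) \<le> M * (norm (z - y))\<^sup>2"
      using assms by (simp add: C11_with_def)
    then show "norm (F z - F y - p y (z - y)) / norm (z - y) \<le> M * norm (z - y)"
      using z(1) by (simp add: power2_eq_square divide_simps mult.assoc)
  qed (auto simp: blinfun.bounded_linear_right)
qed

text \<open>To estimate \<open>(p z - p y) d\<close> for a vector \<open>d\<close> as long as \<open>z - y\<close>, compare the expansions of
\<open>F (z + d)\<close> at \<open>y\<close> and at \<open>z\<close> and the expansion of \<open>F z\<close> at \<open>y\<close>; their errors add up to
\<open>4 + 1 + 1\<close> times \<open>M (norm (z - y))\<^sup>2\<close>. The radius is divided by three so that \<open>z + d\<close> stays in the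
ball.\<close>
lemma C11_with_imp_lipschitz_derivative:
  fixes F :: "'e::real_normed_vector \<Rightarrow> 'f::real_normed_vector"
  assumes "C11_with (ball x r) M p F" "y \<in> ball x (r / 3)" "z \<in> ball x (r / 3)"
  shows "norm (p z - p y) \<le> 6 * M * norm (z - y)"
proof (rule norm_blinfun_bound)
  let ?\<delta> = "norm (z - y)"
  have r: "r > 0" using assms(2) zero_le_dist[of x y] unfolding mem_ball by linarith
  then have yz: "y \<in> ball x r" "z \<in> ball x r" using assms by auto
  have M: "M \<ge> 0" using C11_with_nonneg assms(1) yz by blast
  then show "0 \<le> 6 * M * ?\<delta>" by simp
  have quad: "norm (F b - F a - p a (b - a)) \<le> M * (norm (b - a))\<^sup>2"
    if "a \<in> ball x r" "b \<in> ball x r" for a b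
    using assms(1) that by (simp add: C11_with_def)
  fix v :: 'e
  show "norm ((p z - p y) v) \<le> 6 * M * ?\<delta> * norm v"
  proof (cases "v = 0 \<or> z = y")
    case False
    define d where "d = (?\<delta> / norm v) *\<^sub>R v"
    have nd: "norm d = ?\<delta>" using False by (simp add: d_def)
    have "?\<delta> \<le> norm (z - x) + norm (x - y)"
      using norm_triangle_ineq[of "z - x" "x - y"] by simp
    then have "?\<delta> < 2 * (r / 3)" using assms(2,3) by (simp add: dist_norm norm_minus_commute)
    moreover have "norm (z + d - x) \<le> norm (z - x) + norm d"
      using norm_triangle_ineq[of "z - x" d] by (simp add: algebra_simps)
    ultimately have zd: "z + d \<in> ball x r"
      using nd assms(3) by (simp add: dist_norm norm_minus_commute)
    have "norm (z + d - y) \<le> 2 * ?\<delta>"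
      using norm_triangle_ineq[of "z - y" d] nd by (simp add: algebra_simps)
    then have "M * (norm (z + d - y))\<^sup>2 \<le> M * (2 * ?\<delta>)\<^sup>2"
      using M by (intro mult_left_mono power_mono) auto
    then have 1: "norm (F (z + d) - F y - p y (z + d - y)) \<le> 4 * M * ?\<delta>\<^sup>2"
      using quad[OF yz(1) zd] by (simp add: power_mult_distrib)
    have 2: "norm (F (z + d) - F z - p z d) \<le> M * ?\<delta>\<^sup>2"
      using quad[OF yz(2) zd] nd by simp
    have 3: "norm (F z - F y - p y (z - y)) \<le> M * ?\<delta>\<^sup>2" using quad[OF yz] .
    have tri: "norm (a - b - c) \<le> norm a + norm b + norm c" for a b c :: 'f
      using norm_triangle_ineq4[of "a - b" c] norm_triangle_ineq4[of a b] by linarith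
    have "(p z - p y) d = (F (z + d) - F y - p y (z + d - y)) - (F (z + d) - F z - p z d)
        - (F z - F y - p y (z - y))"
      by (simp add: minus_blinfun.rep_eq blinfun.diff_right blinfun.add_right)
    then have "norm ((p z - p y) d) \<le> norm (F (z + d) - F y - p y (z + d - y))
        + norm (F (z + d) - F z - p z d) + norm (F z - F y - p y (z - y))"
      using tri by metis
    then have "norm ((p z - p y) d) \<le> 6 * M * ?\<delta>\<^sup>2" using 1 2 3 by linarith
    moreover have "norm ((p z - p y) d) = (?\<delta> / norm v) * norm ((p z - p y) v)"
      by (simp add: d_def blinfun.scaleR_right)
    ultimately have "?\<delta> * norm ((p z - p y) v) \<le> ?\<delta> * (6 * M * ?\<delta> * norm v)"
      using False by (simp add: power2_eq_square field_simps)
    then show ?thesis using False by simp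
  qed auto
qed

lemma C11_on_of_C11_at:
  fixes F :: "'e::euclidean_space \<Rightarrow> real"
  assumes "\<And>x. x \<in> S \<Longrightarrow> C11_at F x"
  shows "C11_on S F"
proof -
  define P where "P y = Blinfun (frechet_derivative F (at y))" for y
  have key: "\<exists>r>0. \<exists>L. (\<forall>y\<in>ball x r. (F has_derivative blinfun_apply (P y)) (at y)) \<and>
      L-lipschitz_on (ball x r) P" if xS: "x \<in> S" for x
  proof -
    obtain r M p where r: "r > 0" and F: "C11_with (ball x r) M p F"
      using assms[OF xS] unfolding C11_at_def by blast
    have M: "M \<ge> 0" using C11_with_nonneg[OF F] r by simp
    have P: "P y = p y" if "y \<in> ball x r" for y
      using C11_with_imp_has_derivative[OF F that] frechet_derivative_at
      by (metis P_def blinfun_apply_inverse)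
    have "(6 * M)-lipschitz_on (ball x (r / 3)) P"
    proof (rule lipschitz_onI)
      fix y z assume yz: "y \<in> ball x (r / 3)" "z \<in> ball x (r / 3)"
      then have "y \<in> ball x r" "z \<in> ball x r" using r by auto
      then show "dist (P y) (P z) \<le> 6 * M * dist y z"
        using C11_with_imp_lipschitz_derivative[OF F yz(2,1)] P by (simp add: dist_norm)
    qed (use M in simp)
    moreover have "(F has_derivative blinfun_apply (P y)) (at y)" if "y \<in> ball x (r / 3)" for y
    proof -
      have "y \<in> ball x r" using that r by auto
      then show ?thesis using C11_with_imp_has_derivative[OF F] P by simp
    qed
    ultimately show ?thesis using r by (intro exI[of _ "r / 3"]) auto
  qed
  have "continuous_on S P"
  proof (rule continuous_at_imp_continuous_on, rule ballI)
    fix x assume "x \<in> S"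
    then obtain r L where "r > 0" "L-lipschitz_on (ball x r) P" using key by blast
    then show "isCont P x"
      using lipschitz_on_continuous_on continuous_on_interior by (metis centre_in_ball interior_ball)
  qed
  moreover have "\<forall>x\<in>S. (F has_derivative blinfun_apply (P x)) (at x)"
    using key by (meson centre_in_ball)
  moreover have "\<forall>x\<in>S. \<exists>r>0. \<exists>L. L-lipschitz_on (ball x r \<inter> S) P"
    using key lipschitz_on_subset by (metis inf_le1)
  ultimately show ?thesis unfolding C11_on_def by blast
qed

text \<open>The strict epigraph, translated so that the point \<open>(x, f x)\<close> becomes the origin, is convex and
misses the origin, so a half-space contains it. Its boundary is not vertical because \<open>x\<close>
is an interior point of \<open>S\<close>, and so it is the graph of the wanted affine function.\<close>
lemma convex_on_subgradient:
  fixes f :: "'e::euclidean_space \<Rightarrow> real"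
  assumes "convex_on S f" "open S" "x \<in> S"
  shows "\<exists>p. \<forall>y\<in>S. f x + blinfun_apply p (y - x) \<le> f y"
proof -
  define T where "T = {(y - x, t - f x) |y t. y \<in> S \<and> f y < t}"
  have "convex T"
  proof (rule convexI)
    fix a b :: "'e \<times> real" and u v :: real
    assume "a \<in> T" "b \<in> T" and uv: "0 \<le> u" "0 \<le> v" "u + v = 1"
    then obtain y1 t1 y2 t2 where a: "a = (y1 - x, t1 - f x)" "y1 \<in> S" "f y1 < t1"
      and b: "b = (y2 - x, t2 - f x)" "y2 \<in> S" "f y2 < t2"
      unfolding T_def by blast
    have S: "u *\<^sub>R y1 + v *\<^sub>R y2 \<in> S"
      using convex_on_imp_convex[OF assms(1)] a b uv by (simp add: convexD)
    have "f (u *\<^sub>R y1 + v *\<^sub>R y2) \<le> u * f y1 + v * f y2"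
      using assms(1) a b uv unfolding convex_on_def by simp
    also have "\<dots> < u * t1 + v * t2"
    proof (cases "u = 0")
      case False
      then have "u * f y1 < u * t1" using a uv by simp
      moreover have "v * f y2 \<le> v * t2" using b uv by (simp add: mult_left_mono)
      ultimately show ?thesis by linarith
    qed (use b uv in simp)
    finally have "f (u *\<^sub>R y1 + v *\<^sub>R y2) < u * t1 + v * t2" .
    moreover have "u *\<^sub>R a + v *\<^sub>R b = (u *\<^sub>R y1 + v *\<^sub>R y2 - (u + v) *\<^sub>R x, u * t1 + v * t2 - (u + v) * f x)"
      unfolding a b by (simp add: algebra_simps)
    ultimately show "u *\<^sub>R a + v *\<^sub>R b \<in> T"
      unfolding T_def using S uv(3) by auto
  qed
  moreover have "0 \<notin> T" unfolding T_def by (auto simp: zero_prod_def)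
  ultimately obtain a s where as: "(a, s) \<noteq> 0" and sep: "\<And>z. z \<in> T \<Longrightarrow> 0 \<le> inner (a, s) z"
    using separating_hyperplane_set_0 by (metis surj_pair)
  have sep: "0 \<le> inner a (y - x) + s * (t - f x)" if "y \<in> S" "f y < t" for y t
    using sep[of "(y - x, t - f x)"] that by (auto simp: T_def)
  have "s \<ge> 0" using sep[of x "f x + 1"] assms(3) by simp
  have "s \<noteq> 0"
  proof
    assume "s = 0"
    then have "a \<noteq> 0" using as by (simp add: zero_prod_def)
    obtain e where e: "e > 0" "cball x e \<subseteq> S" using assms(2,3) open_contains_cball by blast
    \<comment> \<open>A step from \<open>x\<close> against the normal leaves the half-space.\<close>
    define y where "y = x - (e / norm a) *\<^sub>R a"
    have "y \<in> S" using e \<open>a \<noteq> 0\<close> by (auto simp: y_def dist_norm intro!: subsetD[OF e(2)])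
    then have "0 \<le> inner a (y - x)" using sep[of y "f y + 1"] \<open>s = 0\<close> by simp
    then have "(e / norm a) * inner a a \<le> 0" by (simp add: y_def)
    moreover have "(e / norm a) * inner a a > 0" using e \<open>a \<noteq> 0\<close> by simp
    ultimately show False by linarith
  qed
  with \<open>s \<ge> 0\<close> have s: "s > 0" by simp
  have "f x + inner (- a /\<^sub>R s) (y - x) \<le> f y" if "y \<in> S" for y
  proof (rule field_le_epsilon)
    fix e :: real assume "e > 0"
    then have "0 \<le> inner a (y - x) + s * (f y + e - f x)" using sep that by simp
    then have "0 \<le> (inner a (y - x) + s * (f y + e - f x)) / s" using s by simp
    then show "f x + inner (- a /\<^sub>R s) (y - x) \<le> f y + e"
      using s by (simp add: field_simps)
  qed
  then show ?thesis
    by (intro exI[of _ "blinfun_inner_left (- a /\<^sub>R s)"]) (simp add: inner_commute)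
qed

text \<open>A subgradient at \<open>y\<close> is bounded by the oscillation of \<open>f\<close> on a ball around \<open>y\<close> divided by its
radius.\<close>
lemma convex_on_locally_bounded_subgradients:
  fixes f :: "'e::euclidean_space \<Rightarrow> real"
  assumes "convex_on S f" "open S" "x \<in> S"
  obtains r M p where "r > 0" "ball x r \<subseteq> S"
    "\<And>y. y \<in> ball x r \<Longrightarrow> \<bar>f y\<bar> \<le> M" "\<And>y. y \<in> ball x r \<Longrightarrow> norm (p y) \<le> M"
    "\<And>y z. y \<in> ball x r \<Longrightarrow> z \<in> S \<Longrightarrow> f y + blinfun_apply (p y) (z - y) \<le> f z"
proof -
  obtain e where e: "e > 0" "cball x e \<subseteq> S" using assms(2,3) open_contains_cball by blast
  define r where "r = e / 2"
  have r: "r > 0" using e by (simp add: r_def)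
  have "continuous_on (cball x e) f"
    using convex_on_continuous[OF assms(2,1)] e(2) continuous_on_subset by blast
  then have "bounded (f ` cball x e)"
    by (intro compact_imp_bounded compact_continuous_image) auto
  then obtain B where "\<forall>y\<in>cball x e. \<bar>f y\<bar> \<le> B" by (auto simp: bounded_iff)
  then have B: "\<bar>f y\<bar> \<le> B" if "y \<in> cball x e" for y using that by blast
  obtain p where p: "\<And>y z. y \<in> S \<Longrightarrow> z \<in> S \<Longrightarrow> f y + blinfun_apply (p y) (z - y) \<le> f z"
    using convex_on_subgradient[OF assms(1,2)] by metis
  have B0: "B \<ge> 0" using B[of x] e by force
  have "norm (p y) \<le> 2 * B / r" if y: "y \<in> ball x r" for y
  proof (rule norm_blinfun_bound)
    show "0 \<le> 2 * B / r" using B0 r by simp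
    have small: "p y d \<le> 2 * B" if "norm d \<le> r" for d
    proof -
      have "norm (y + d - x) \<le> norm (y - x) + norm d"
        using norm_triangle_ineq[of "y - x" d] by (simp add: algebra_simps)
      then have yd: "y + d \<in> cball x e" "y \<in> cball x e"
        using y that r by (auto simp: r_def dist_norm norm_minus_commute)
      then have "f y + p y d \<le> f (y + d)" using p[of y "y + d"] subsetD[OF e(2)] by simp
      then show ?thesis using B[OF yd(1)] B[OF yd(2)] by linarith
    qed
    fix v :: 'e
    show "norm (p y v) \<le> 2 * B / r * norm v"
    proof (cases "v = 0")
      case False
      define d where "d = (r / norm v) *\<^sub>R v"
      have "norm d \<le> r" using False r by (simp add: d_def)
      then have "\<bar>p y d\<bar> \<le> 2 * B"
        using small[of d] small[of "- d"] by (simp add: blinfun.minus_right)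
      moreover have "\<bar>p y d\<bar> = (r / norm v) * \<bar>p y v\<bar>"
        using r by (simp add: d_def blinfun.scaleR_right abs_mult)
      ultimately show ?thesis using r False by (simp add: field_simps)
    qed simp
  qed
  then have np: "norm (p y) \<le> max B (2 * B / r)" if "y \<in> ball x r" for y
    using that by (meson max.coboundedI2)
  have sub: "ball x r \<subseteq> cball x e" using e by (auto simp: r_def)
  then have nf: "\<bar>f y\<bar> \<le> max B (2 * B / r)" if "y \<in> ball x r" for y
    using that B by (meson max.coboundedI1 subsetD)
  have rS: "ball x r \<subseteq> S" using sub e(2) by blast
  show ?thesis
    by (rule that[OF r rS nf np]) (use p rS in auto)
qed

lemma concave_on_imp_semiconcave_at:
  fixes f :: "'e::euclidean_space \<Rightarrow> real"
  assumes "concave_on S f" "open S" "x \<in> S"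
  shows "semiconcave_at f x"
proof -
  obtain r M p where r: "r > 0" "ball x r \<subseteq> S" and
    b: "\<And>y. y \<in> ball x r \<Longrightarrow> \<bar>- f y\<bar> \<le> M" "\<And>y. y \<in> ball x r \<Longrightarrow> norm (p y) \<le> M" and
    s: "\<And>y z. y \<in> ball x r \<Longrightarrow> z \<in> S \<Longrightarrow> - f y + blinfun_apply (p y) (z - y) \<le> - f z"
    using convex_on_locally_bounded_subgradients[of S "\<lambda>y. - f y" x] assms
    unfolding concave_on_def by blast
  have M: "0 \<le> M" using order_trans[OF abs_ge_zero b(1)[of x]] r(1) by simp
  have "semiconcave_with (ball x r) M (\<lambda>y. - p y) f"
    unfolding semiconcave_with_def
  proof (intro ballI conjI)
    fix y assume y: "y \<in> ball x r"
    show "\<bar>f y\<bar> \<le> M" "norm (- p y) \<le> M" using b[OF y] by auto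
    fix z assume "z \<in> ball x r"
    then have "- f y + blinfun_apply (p y) (z - y) \<le> - f z" using s y r(2) by blast
    moreover have "0 \<le> M * (norm (z - y))\<^sup>2" using M by simp
    ultimately show "f z \<le> f y + (- p y) (z - y) + M * (norm (z - y))\<^sup>2"
      by (simp add: uminus_blinfun.rep_eq)
  qed
  then show ?thesis using r(1) semiconcave_at_def by blast
qed

section \<open>Elementary C11 functions and operations on them\<close>
lemma C11_at_const: "C11_at (\<lambda>y. a) x"
  by (rule C11_at_of_lipschitz_derivative[of 1 _ _ "\<lambda>y. 0" 0]) (auto simp: zero_blinfun.rep_eq)

lemma C11_at_add:
  fixes F G :: "'e::real_normed_vector \<Rightarrow> real"
  assumes "C11_at F x" "C11_at G x"
  shows "C11_at (\<lambda>y. F y + G y) x"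
  using assms semiconcave_at_add[of F x G] semiconcave_at_add[of "\<lambda>y. - F y" x "\<lambda>y. - G y"]
  by (simp add: C11_at_iff_semiconcave)

lemma C11_at_diff:
  fixes F G :: "'e::real_normed_vector \<Rightarrow> real"
  assumes "C11_at F x" "C11_at G x"
  shows "C11_at (\<lambda>y. F y - G y) x"
  using assms semiconcave_at_add[of F x "\<lambda>y. - G y"] semiconcave_at_add[of "\<lambda>y. - F y" x G]
  by (simp add: C11_at_iff_semiconcave)

lemma C11_at_compose:
  assumes "C11_at (F :: 'f::real_normed_vector \<Rightarrow> real) (\<psi> x)" "C11_at \<psi> x"
  shows "C11_at (\<lambda>y. F (\<psi> y)) x"
  using assms semiconcave_at_compose[of F \<psi> x] semiconcave_at_compose[of "\<lambda>y. - F y" \<psi> x]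
  by (simp add: C11_at_iff_semiconcave)

lemma C11_at_norm_power2:
  fixes a x :: "'e::real_inner"
  shows "C11_at (\<lambda>y. (norm (y - a))\<^sup>2) x"
proof (rule C11_at_of_lipschitz_derivative[of 1 x _ "\<lambda>y. 2 *\<^sub>R blinfun_inner_left (y - a)" 2])
  fix y z :: 'e
  show "((\<lambda>y. (norm (y - a))\<^sup>2) has_derivative (2 *\<^sub>R blinfun_inner_left (y - a))) (at y)"
    unfolding power2_norm_eq_inner
    by (auto intro!: derivative_eq_intros simp: scaleR_blinfun.rep_eq inner_commute)
  show "norm (2 *\<^sub>R blinfun_inner_left (z - a) - 2 *\<^sub>R blinfun_inner_left (y - a)) \<le> 2 * norm (z - y)"
  proof (rule norm_blinfun_bound)
    fix v :: 'e
    have "(2 *\<^sub>R blinfun_inner_left (z - a) - 2 *\<^sub>R blinfun_inner_left (y - a)) v = 2 * inner (z - y) v"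
      by (simp add: minus_blinfun.rep_eq scaleR_blinfun.rep_eq inner_diff algebra_simps inner_commute)
    then show "norm ((2 *\<^sub>R blinfun_inner_left (z - a) - 2 *\<^sub>R blinfun_inner_left (y - a)) v)
        \<le> 2 * norm (z - y) * norm v"
      using Cauchy_Schwarz_ineq2[of "z - y" v] by (simp add: abs_mult)
  qed simp
qed simp

text \<open>The quadratic spline with knots \<open>0, 1, 2\<close> that rises from \<open>0\<close> to \<open>1\<close>. Bump functions only need to
be \<open>C\<^sup>1\<^sup>,\<^sup>1\<close> here, which allows this elementary choice in place of exponentials.\<close>
definition C11_step :: "real \<Rightarrow> real" where
  "C11_step t = ((max 0 t)\<^sup>2 - 2 * (max 0 (t - 1))\<^sup>2 + (max 0 (t - 2))\<^sup>2) / 2"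

lemma C11_at_positive_part_power2: "C11_at (\<lambda>t::real. (max 0 (t - c))\<^sup>2) x"
proof (rule C11_at_of_lipschitz_derivative[of 1 x _ "\<lambda>t. (2 * max 0 (t - c)) *\<^sub>R id_blinfun" 2])
  fix s t :: real
  show "norm ((2 * max 0 (t - c)) *\<^sub>R id_blinfun - (2 * max 0 (s - c)) *\<^sub>R (id_blinfun :: real \<Rightarrow>\<^sub>L real))
      \<le> 2 * norm (t - s)"
    unfolding scaleR_diff_left[symmetric] by (simp add: max_def abs_if)
  show "((\<lambda>t. (max 0 (t - c))\<^sup>2) has_derivative ((2 * max 0 (s - c)) *\<^sub>R id_blinfun)) (at s)"
  proof (rule has_derivativeI_sandwich[of 1])
    show "((\<lambda>t. \<bar>t - s\<bar>) \<longlongrightarrow> 0) (at s)" by (auto intro!: tendsto_eq_intros)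
    fix t :: real assume "t \<noteq> s"
    have "\<bar>(max 0 (t - c))\<^sup>2 - (max 0 (s - c))\<^sup>2 - 2 * max 0 (s - c) * (t - s)\<bar> \<le> (t - s)\<^sup>2"
    proof (cases "s \<ge> c"; cases "t \<ge> c")
      assume "s \<ge> c" "t \<ge> c"
      then have "(max 0 (t - c))\<^sup>2 - (max 0 (s - c))\<^sup>2 - 2 * max 0 (s - c) * (t - s) = (t - s)\<^sup>2"
        by (simp add: power2_eq_square algebra_simps)
      then show ?thesis by simp
    next
      assume c: "s \<ge> c" "\<not> t \<ge> c"
      then have "0 \<le> (s - c) * (c - t)" by simp
      moreover have "(t - s)\<^sup>2 = (s - c)\<^sup>2 + 2 * ((s - c) * (c - t)) + (c - t)\<^sup>2"
        by (simp add: power2_eq_square algebra_simps)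
      moreover have "(max 0 (t - c))\<^sup>2 - (max 0 (s - c))\<^sup>2 - 2 * max 0 (s - c) * (t - s)
          = (s - c)\<^sup>2 + 2 * ((s - c) * (c - t))"
        using c by (simp add: power2_eq_square algebra_simps)
      ultimately show ?thesis by simp
    next
      assume c: "\<not> s \<ge> c" "t \<ge> c"
      then have "(t - c)\<^sup>2 \<le> (t - s)\<^sup>2" by (intro power_mono) auto
      then show ?thesis using c by simp
    qed auto
    then have "norm ((max 0 (t - c))\<^sup>2 - (max 0 (s - c))\<^sup>2 - 2 * max 0 (s - c) * (t - s)) \<le> \<bar>t - s\<bar> * \<bar>t - s\<bar>"
      by (simp add: power2_eq_square)
    then show "norm ((max 0 (t - c))\<^sup>2 - (max 0 (s - c))\<^sup>2
        - ((2 * max 0 (s - c)) *\<^sub>R id_blinfun) (t - s)) / norm (t - s) \<le> \<bar>t - s\<bar>"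
      using \<open>t \<noteq> s\<close> by (simp add: scaleR_blinfun.rep_eq divide_simps)
  qed (auto simp: blinfun.bounded_linear_right)
qed simp

lemma C11_at_C11_step: "C11_at C11_step x"
proof -
  have "C11_at (\<lambda>t. (1/2) * (((max 0 (t - 0))\<^sup>2 - 2 * (max 0 (t - 1))\<^sup>2) + (max 0 (t - 2))\<^sup>2)) x"
    by (intro C11_at_mult C11_at_add C11_at_diff C11_at_const C11_at_positive_part_power2)
  moreover have "(\<lambda>t. (1/2) * (((max 0 (t - 0))\<^sup>2 - 2 * (max 0 (t - 1))\<^sup>2) + (max 0 (t - 2))\<^sup>2)) = C11_step"
    by (simp add: C11_step_def fun_eq_iff)
  ultimately show ?thesis by simp
qed

lemma C11_step_eq_0: "t \<le> 0 \<Longrightarrow> C11_step t = 0"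
  by (simp add: C11_step_def)

lemma C11_step_eq_1: "t \<ge> 2 \<Longrightarrow> C11_step t = 1"
  by (simp add: C11_step_def power2_eq_square algebra_simps)

lemma C11_step_bounds: "0 \<le> C11_step t" "C11_step t \<le> 1"
proof -
  consider "t \<le> 0" | "0 \<le> t" "t \<le> 1" | "1 \<le> t" "t \<le> 2" | "t \<ge> 2" by linarith
  then have "0 \<le> C11_step t \<and> C11_step t \<le> 1"
  proof cases
    case 2
    then have "C11_step t = t\<^sup>2 / 2" by (simp add: C11_step_def)
    moreover have "t\<^sup>2 \<le> 1" using 2 by (simp add: power_le_one)
    moreover have "0 \<le> t\<^sup>2" by simp
    ultimately show ?thesis by linarith
  next
    case 3
    then have eq: "C11_step t = 1 - (2 - t)\<^sup>2 / 2"
      by (simp add: C11_step_def power2_eq_square field_simps)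
    have "(2 - t)\<^sup>2 \<le> 1" using 3 by (intro power_le_one) auto
    moreover have "0 \<le> (2 - t)\<^sup>2" by simp
    ultimately show ?thesis unfolding eq by linarith
  qed (simp_all add: C11_step_eq_0 C11_step_eq_1)
  then show "0 \<le> C11_step t" "C11_step t \<le> 1" by auto
qed

section \<open>Convex envelopes and the local insertion theorem\<close>
text \<open>These are the affine minorants of the pointwise infimum of the family \<open>Q\<close>. Working with the family
itself avoids infima that may be unbounded.\<close>
definition affine_minorants ::
    "('e::real_normed_vector \<Rightarrow> real) set \<Rightarrow> (real \<times> ('e \<Rightarrow>\<^sub>L real)) set" where
  "affine_minorants Q = {(b, l). \<forall>q\<in>Q. \<forall>z. b + blinfun_apply l z \<le> q z}"

definition convex_envelope :: "('e::real_normed_vector \<Rightarrow> real) set \<Rightarrow> 'e \<Rightarrow> real" where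
  "convex_envelope Q z = (SUP (b, l) \<in> affine_minorants Q. b + blinfun_apply l z)"

lemma convex_envelope_upper:
  assumes "Q \<noteq> {}" "(b, l) \<in> affine_minorants Q"
  shows "b + l z \<le> convex_envelope Q z"
proof -
  obtain q where "q \<in> Q" using assms(1) by blast
  then have "bdd_above ((\<lambda>(b, l). b + blinfun_apply l z) ` affine_minorants Q)"
    by (auto simp: affine_minorants_def bdd_above_def intro!: exI[of _ "q z"])
  from cSUP_upper[OF assms(2) this] show ?thesis by (simp add: convex_envelope_def)
qed

lemma convex_envelope_least:
  assumes "affine_minorants Q \<noteq> {}" "\<And>b l. (b, l) \<in> affine_minorants Q \<Longrightarrow> b + l z \<le> c"
  shows "convex_envelope Q z \<le> c"
  unfolding convex_envelope_def using assms by (intro cSUP_least) auto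

text \<open>The convex envelope of a function whose second differences are bounded above is \<open>C\<^sup>1\<^sup>,\<^sup>1\<close>. If
\<open>b1 + l1\<close> and \<open>b2 + l2\<close> are affine minorants, then shifting them by \<open>d\<close> and \<open>- d\<close> and
averaging gives, after subtracting \<open>K (norm d)\<^sup>2\<close>, another affine minorant, because the second
differences of the family are at most \<open>2 K (norm d)\<^sup>2\<close>. So the envelope \<open>H\<close> satisfies the same
bound on second differences. A subgradient of the convex function \<open>H\<close> bounds it from below, and the
bound on second differences then turns the lower bound at \<open>y - d\<close> into a quadratic upper bound at
\<open>y + d\<close>.\<close>
lemma C11_at_convex_envelope:
  fixes Q :: "('e::euclidean_space \<Rightarrow> real) set"
  assumes Q: "Q \<noteq> {}" and N: "affine_minorants Q \<noteq> {}"
    and semi: "\<And>q z d. q \<in> Q \<Longrightarrow> q (z + d) + q (z - d) \<le> 2 * q z + 2 * K * (norm d)\<^sup>2"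
  shows "C11_at (convex_envelope Q) x"
proof -
  let ?H = "convex_envelope Q"
  have cvx: "convex_on UNIV ?H"
  proof (rule convex_onI)
    fix t :: real and y z :: 'e assume t: "0 < t" "t < 1"
    show "?H ((1 - t) *\<^sub>R y + t *\<^sub>R z) \<le> (1 - t) * ?H y + t * ?H z"
    proof (rule convex_envelope_least[OF N])
      fix b l assume bl: "(b, l) \<in> affine_minorants Q"
      have "b + l ((1 - t) *\<^sub>R y + t *\<^sub>R z) = (1 - t) * (b + l y) + t * (b + l z)"
        unfolding blinfun.add_right blinfun.scaleR_right by (simp add: algebra_simps)
      also have "\<dots> \<le> (1 - t) * ?H y + t * ?H z"
        using t convex_envelope_upper[OF Q bl] by (intro add_mono mult_left_mono) auto
      finally show "b + l ((1 - t) *\<^sub>R y + t *\<^sub>R z) \<le> (1 - t) * ?H y + t * ?H z" .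
    qed
  qed simp
  have Hsemi: "?H (z + d) + ?H (z - d) \<le> 2 * ?H z + 2 * K * (norm d)\<^sup>2" for z d
  proof -
    have *: "(b1 + l1 (z + d)) + (b2 + l2 (z - d)) \<le> 2 * ?H z + 2 * K * (norm d)\<^sup>2"
      if 1: "(b1, l1) \<in> affine_minorants Q" and 2: "(b2, l2) \<in> affine_minorants Q" for b1 l1 b2 l2
    proof -
      \<comment> \<open>The average of the two shifted minorants, lowered by the second difference
        bound.\<close>
    define b where "b = (b1 + l1 d + b2 - l2 d) / 2 - K * (norm d)\<^sup>2"
      define l where "l = (1/2) *\<^sub>R (l1 + l2)"
      have eq: "2 * (b + l w) = (b1 + l1 (w + d)) + (b2 + l2 (w - d)) - 2 * K * (norm d)\<^sup>2" for w
        by (simp add: b_def l_def scaleR_blinfun.rep_eq plus_blinfun.rep_eq blinfun.add_right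
            blinfun.diff_right field_simps)
      have "(b, l) \<in> affine_minorants Q"
        unfolding affine_minorants_def
      proof (clarify)
        fix q w assume q: "q \<in> Q"
        have "b1 + l1 (w + d) \<le> q (w + d)" "b2 + l2 (w - d) \<le> q (w - d)"
          using 1 2 q by (auto simp: affine_minorants_def)
        then have "2 * (b + l w) \<le> 2 * q w"
          unfolding eq using semi[OF q, of w d] by linarith
        then show "b + l w \<le> q w" by simp
      qed
      from convex_envelope_upper[OF Q this, of z] have "2 * (b + l z) \<le> 2 * ?H z" by simp
      then show ?thesis unfolding eq by linarith
    qed
    have "?H (z + d) \<le> 2 * ?H z + 2 * K * (norm d)\<^sup>2 - (b2 + l2 (z - d))"
      if "(b2, l2) \<in> affine_minorants Q" for b2 l2
      using *[OF _ that] by (intro convex_envelope_least[OF N]) force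
    then have "?H (z - d) \<le> 2 * ?H z + 2 * K * (norm d)\<^sup>2 - ?H (z + d)"
      by (intro convex_envelope_least[OF N]) force
    then show ?thesis by linarith
  qed
  obtain r M p where r: "r > 0" "ball x r \<subseteq> UNIV" and
    b: "\<And>y. y \<in> ball x r \<Longrightarrow> \<bar>?H y\<bar> \<le> M" "\<And>y. y \<in> ball x r \<Longrightarrow> norm (p y) \<le> M" and
    s: "\<And>y z. y \<in> ball x r \<Longrightarrow> z \<in> UNIV \<Longrightarrow> ?H y + blinfun_apply (p y) (z - y) \<le> ?H z"
    by (rule convex_on_locally_bounded_subgradients[OF cvx open_UNIV UNIV_I]) blast
  have "C11_with (ball x r) (max M (2 * K)) p ?H"
    unfolding C11_with_def
  proof (intro ballI conjI)
    fix y assume y: "y \<in> ball x r"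
    show "norm (?H y) \<le> max M (2 * K)" "norm (p y) \<le> max M (2 * K)" using b[OF y] by auto
    fix z
    have 1: "?H y + p y (z - y) \<le> ?H z" using s[OF y] by simp
    have 2: "?H y - p y (z - y) \<le> ?H (y - (z - y))"
      using s[OF y, of "y - (z - y)"] by (simp add: blinfun.diff_right)
    have 3: "?H z + ?H (y - (z - y)) \<le> 2 * ?H y + 2 * K * (norm (z - y))\<^sup>2"
      using Hsemi[of y "z - y"] by simp
    have "2 * K * (norm (z - y))\<^sup>2 \<le> max M (2 * K) * (norm (z - y))\<^sup>2"
      by (intro mult_right_mono) auto
    then show "norm (?H z - ?H y - p y (z - y)) \<le> max M (2 * K) * (norm (z - y))\<^sup>2"
      using 1 2 3 unfolding real_norm_def by linarith
  qed
  then show ?thesis using r(1) C11_at_def by blast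
qed

lemma power2_norm_add:
  "(norm (a + b :: 'e::real_inner))\<^sup>2 = (norm a)\<^sup>2 + 2 * inner a b + (norm b)\<^sup>2"
  by (simp add: power2_norm_eq_inner inner_add inner_commute)

text \<open>Adding \<open>C (norm (z - x))\<^sup>2\<close> with \<open>C\<close> large makes \<open>F\<close> convex near \<open>x\<close>, so that the convex envelope
of the modified \<open>G\<close> still lies above the modified \<open>F\<close>; subtracting the quadratic term again gives
\<open>h\<close>. To have everything defined on the whole space, \<open>G\<close> is replaced by the infimum of its touching
paraboloids, and \<open>F\<close> by its modified tangent affine functions, based at points of the ball of half
the radius. Inside \<open>ball x R\<close> such a tangent lies below the paraboloids since \<open>F \<le> G\<close>. Outside,
the point of tangency is at distance at least \<open>R / 2\<close>, and \<open>C\<close> is chosen so that the quadratic gap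
\<open>C (norm (z - y))\<^sup>2\<close> then dominates all other terms.\<close>
lemma C11_insertion_at:
  fixes F G :: "'e::euclidean_space \<Rightarrow> real"
  assumes G: "semiconcave_at G x" and F: "semiconcave_at (\<lambda>y. - F y) x"
    and le: "\<And>y. F y \<le> G y"
  obtains h r where "r > 0" "\<And>y. C11_at h y" "\<And>y. y \<in> ball x r \<Longrightarrow> F y \<le> h y \<and> h y \<le> G y"
proof -
  obtain R M p q where R: "R > 0" and M: "M \<ge> 0"
    and G: "semiconcave_with (ball x R) M p G"
    and F: "semiconcave_with (ball x R) M q (\<lambda>y. - F y)"
    using semiconcave_at_pair[OF G F] by blast
  define C where "C = 9 * M / R\<^sup>2 + 2 * M / R + M"
  have C: "C \<ge> M" "C \<ge> 0" using R M by (auto simp: C_def)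
  define par where "par w z = G w + p w (z - w) + M * (norm (z - w))\<^sup>2 + C * (norm (z - x))\<^sup>2" for w z
  define Q where "Q = par ` ball x R"
  define H where "H = convex_envelope Q"
  define h where "h z = H z - C * (norm (z - x))\<^sup>2" for z
  have xR: "x \<in> ball x R" using R by simp
  have Q: "Q \<noteq> {}" unfolding Q_def using R by simp
  have Gb: "\<bar>G w\<bar> \<le> M" "norm (p w) \<le> M" if "w \<in> ball x R" for w
    using G that by (auto simp: semiconcave_with_def)
  have Fb: "\<bar>F w\<bar> \<le> M" "norm (q w) \<le> M" if "w \<in> ball x R" for w
    using F that by (auto simp: semiconcave_with_def)
  have Gup: "G z \<le> G w + p w (z - w) + M * (norm (z - w))\<^sup>2" if "w \<in> ball x R" "z \<in> ball x R" for w z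
    using G that by (auto simp: semiconcave_with_def)
  have Flo: "F y - q y (z - y) - M * (norm (z - y))\<^sup>2 \<le> F z" if "y \<in> ball x R" "z \<in> ball x R" for y z
    using F that by (force simp: semiconcave_with_def)
  have app: "\<bar>l v\<bar> \<le> M * norm v" if "norm l \<le> M" for l :: "'e \<Rightarrow>\<^sub>L real" and v
    using norm_blinfun[of l v] mult_right_mono[OF that, of "norm v"] by simp
  \<comment> \<open>The tangent to the modified \<open>F\<close> at \<open>y\<close> lies below the
    modified paraboloid at \<open>w\<close>; the quadratic terms centred at \<open>x\<close> have
    been cancelled, which leaves the one centred at \<open>y\<close>.\<close>
  have below: "F y - q y (z - y) \<le> G w + p w (z - w) + M * (norm (z - w))\<^sup>2 + C * (norm (z - y))\<^sup>2"
    if y: "y \<in> ball x (R / 2)" and w: "w \<in> ball x R" for y z w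
  proof (cases "z \<in> ball x R")
    case True
    have yR: "y \<in> ball x R" using y R by auto
    have "M * (norm (z - y))\<^sup>2 \<le> C * (norm (z - y))\<^sup>2" using C by (intro mult_right_mono) auto
    then show ?thesis using Flo[OF yR True] Gup[OF w True] le[of z] by linarith
  next
    case False
    let ?t = "norm (z - y)" and ?s = "norm (z - w)"
    have yR: "y \<in> ball x R" using y R by auto
    have "norm (z - x) \<le> ?t + norm (y - x)"
      using norm_triangle_ineq[of "z - y" "y - x"] by simp
    then have t: "R / 2 \<le> ?t" using False y by (simp add: dist_norm norm_minus_commute)
    have 1: "F y - q y (z - y) \<le> M + M * ?t"
      using Fb[OF yR] app[of "q y" "z - y"] by linarith
    have 2: "- M - M * ?s \<le> G w + p w (z - w)"
      using Gb[OF w] app[of "p w" "z - w"] by linarith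
    have "0 \<le> M * (?s - 1/2)\<^sup>2" using M by simp
    then have 3: "M * ?s \<le> M * ?s\<^sup>2 + M / 4"
      by (simp add: power2_eq_square algebra_simps)
    \<comment> \<open>The first summand of \<open>C\<close> absorbs the constant \<open>M + M + M /
      4\<close>, the second absorbs \<open>M * ?t\<close>.\<close>
    have "(R / 2)\<^sup>2 \<le> ?t\<^sup>2" using t R by (intro power_mono) auto
    then have "9 * M / R\<^sup>2 * (R / 2)\<^sup>2 \<le> 9 * M / R\<^sup>2 * ?t\<^sup>2"
      using M by (intro mult_left_mono) auto
    then have 4: "9 * M / 4 \<le> 9 * M / R\<^sup>2 * ?t\<^sup>2" using R by (simp add: power_divide)
    have "2 * M / R * (R / 2) * ?t \<le> 2 * M / R * ?t * ?t"
      using M R t by (intro mult_right_mono mult_left_mono) auto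
    then have 5: "M * ?t \<le> 2 * M / R * ?t\<^sup>2" using R by (simp add: power2_eq_square mult.assoc)
    have "C * ?t\<^sup>2 = 9 * M / R\<^sup>2 * ?t\<^sup>2 + 2 * M / R * ?t\<^sup>2 + M * ?t\<^sup>2"
      by (simp add: C_def distrib_right)
    moreover have "0 \<le> M * ?t\<^sup>2" using M by simp
    ultimately show ?thesis using 1 2 3 4 5 by linarith
  qed
  have split: "C * (norm (z - x))\<^sup>2 = C * (norm (y - x))\<^sup>2 + 2 * C * inner (y - x) (z - y) + C * (norm (z - y))\<^sup>2"
    for y z
  proof -
    have "(norm (z - x))\<^sup>2 = (norm (y - x))\<^sup>2 + 2 * inner (y - x) (z - y) + (norm (z - y))\<^sup>2"
      using power2_norm_add[of "y - x" "z - y"] by simp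
    then show ?thesis by (simp only: distrib_left mult.assoc mult.left_commute)
  qed
  have minorant: "\<exists>b l. (b, l) \<in> affine_minorants Q \<and> b + l y = F y + C * (norm (y - x))\<^sup>2"
    if y: "y \<in> ball x (R / 2)" for y
  proof -
    define l where "l = (2 * C) *\<^sub>R blinfun_inner_left (y - x) - q y"
    define b where "b = F y + C * (norm (y - x))\<^sup>2 - l y"
    have bl: "b + l z = F y - q y (z - y) + C * (norm (y - x))\<^sup>2 + 2 * C * inner (y - x) (z - y)" for z
      by (simp add: b_def l_def minus_blinfun.rep_eq scaleR_blinfun.rep_eq blinfun.diff_right
          inner_diff_right inner_commute algebra_simps)
    have "b + l z \<le> par w z" if "w \<in> ball x R" for w z
      using below[OF y that, of z] split[of z y] unfolding bl par_def by linarith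
    then have "(b, l) \<in> affine_minorants Q"
      unfolding affine_minorants_def Q_def by auto
    moreover have "b + l y = F y + C * (norm (y - x))\<^sup>2" by (simp add: b_def)
    ultimately show ?thesis by blast
  qed
  have N: "affine_minorants Q \<noteq> {}" using minorant[of x] R by auto
  have par_semi: "par w (z + d) + par w (z - d) \<le> 2 * par w z + 2 * (M + C) * (norm d)\<^sup>2" for w z d
  proof -
    have e: "norm (z + d - a) = norm ((z - a) + d)" "norm (z - d - a) = norm ((z - a) + (- d))" for a
      by (simp_all add: algebra_simps)
    have "(norm (z + d - a))\<^sup>2 + (norm (z - d - a))\<^sup>2 = 2 * (norm (z - a))\<^sup>2 + 2 * (norm d)\<^sup>2" for a
      unfolding e power2_norm_add by simp
    then have "k * (norm (z + d - a))\<^sup>2 + k * (norm (z - d - a))\<^sup>2 = 2 * k * (norm (z - a))\<^sup>2 + 2 * k * (norm d)\<^sup>2"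
      for a k by (metis (no_types, opaque_lifting) distrib_left mult.left_commute mult.assoc)
    from this[of M w] this[of C x]
    have "par w (z + d) + par w (z - d) = 2 * par w z + 2 * M * (norm d)\<^sup>2 + 2 * C * (norm d)\<^sup>2"
      unfolding par_def by (simp add: blinfun.diff_right blinfun.add_right)
    then show ?thesis by (simp add: algebra_simps)
  qed
  have "C11_at H y" for y
    unfolding H_def
    by (rule C11_at_convex_envelope[OF Q N, of "M + C"]) (use M C par_semi in \<open>auto simp: Q_def\<close>)
  then have "C11_at h y" for y
    unfolding h_def by (intro C11_at_diff C11_at_mult C11_at_const C11_at_norm_power2)
  moreover have "F y \<le> h y \<and> h y \<le> G y" if y: "y \<in> ball x (R / 2)" for y
  proof
    obtain b l where "(b, l) \<in> affine_minorants Q" "b + l y = F y + C * (norm (y - x))\<^sup>2"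
      using minorant[OF y] by blast
    then show "F y \<le> h y"
      using convex_envelope_upper[OF Q, of b l y] by (simp add: h_def H_def)
    have "par y \<in> Q" using y R by (auto simp: Q_def)
    then have "H y \<le> par y y"
      unfolding H_def by (intro convex_envelope_least[OF N]) (auto simp: affine_minorants_def)
    then show "h y \<le> G y" by (simp add: h_def par_def)
  qed
  ultimately show ?thesis using that[of "R / 2" h] R by simp
qed

section \<open>Semiconcave and C11 functions on a manifold\<close>
lemma chart_simps:
  assumes "is_chart C"
  shows "open (chart_dom C)" "open (chart_img C)"
    "continuous_on (chart_dom C) (chart_map C)" "continuous_on (chart_img C) (chart_inv C)"
    "x \<in> chart_dom C \<Longrightarrow> chart_map C x \<in> chart_img C"
    "x \<in> chart_dom C \<Longrightarrow> chart_inv C (chart_map C x) = x"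
    "p \<in> chart_img C \<Longrightarrow> chart_inv C p \<in> chart_dom C"
    "p \<in> chart_img C \<Longrightarrow> chart_map C (chart_inv C p) = p"
  using assms unfolding is_chart_def homeomorphism_def by auto

lemma open_chart_map_image:
  assumes "is_chart C" "open W" "W \<subseteq> chart_dom C"
  shows "open (chart_map C ` W)"
proof -
  have "chart_map C ` W = chart_img C \<inter> chart_inv C -` W"
    using assms(3) chart_simps[OF assms(1)] by (force simp: image_iff)
  then show ?thesis
    using continuous_open_preimage[OF chart_simps(4,2)[OF assms(1)] assms(2)] by simp
qed

lemma open_chart_map_vimage:
  assumes "is_chart C" "open T"
  shows "open (chart_dom C \<inter> chart_map C -` T)"
  using continuous_open_preimage[OF chart_simps(3,1)[OF assms(1)] assms(2)] .

text \<open>The coordinate representation in \<open>D\<close> is the one in \<open>C\<close> composed with the transition map, but only on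
the part of the image of \<open>D\<close> that corresponds to the overlap.\<close>
lemma semiconcave_at_change_chart:
  fixes C D :: "('a::topological_space, 'e::euclidean_space) chart"
  assumes "is_chart C" "is_chart D" "x \<in> chart_dom C" "x \<in> chart_dom D"
    and "C11_at (transition D C) (chart_map D x)"
    and "semiconcave_at (f \<circ> chart_inv C) (chart_map C x)"
  shows "semiconcave_at (f \<circ> chart_inv D) (chart_map D x)"
proof (rule semiconcave_at_cong)
  let ?W = "chart_dom C \<inter> chart_dom D"
  show "open (chart_map D ` ?W)"
    using assms(1,2) by (intro open_chart_map_image) (auto intro: chart_simps)
  show "chart_map D x \<in> chart_map D ` ?W" using assms(3,4) by blast
  show "semiconcave_at (\<lambda>p. (f \<circ> chart_inv C) (transition D C p)) (chart_map D x)"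
    using semiconcave_at_compose[of "f \<circ> chart_inv C" "transition D C" "chart_map D x"] assms
    by (simp add: transition_def chart_simps)
  show "(f \<circ> chart_inv C) (transition D C p) = (f \<circ> chart_inv D) p" if "p \<in> chart_map D ` ?W" for p
    using that assms(1,2) by (auto simp: transition_def chart_simps)
qed

locale smooth_manifold =
  fixes A :: "('a::{t2_space, second_countable_topology}, 'e::euclidean_space) chart set"
  assumes atlas: "smooth_atlas A"
begin

definition semiconcave_near :: "('a \<Rightarrow> real) \<Rightarrow> 'a \<Rightarrow> bool" where
  "semiconcave_near f x \<longleftrightarrow>
     (\<exists>C\<in>smooth_charts A. x \<in> chart_dom C \<and> semiconcave_at (f \<circ> chart_inv C) (chart_map C x))"

definition C11_near :: "('a \<Rightarrow> real) \<Rightarrow> 'a \<Rightarrow> bool" where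
  "C11_near f x \<longleftrightarrow> semiconcave_near f x \<and> semiconcave_near (\<lambda>y. - f y) x"

lemma smooth_charts_is_chart: "C \<in> smooth_charts A \<Longrightarrow> is_chart C"
  by (simp add: smooth_charts_def)

lemma chart_around:
  obtains E where "E \<in> A" "E \<in> smooth_charts A" "is_chart E" "x \<in> chart_dom E"
proof -
  obtain E where E: "E \<in> A" "x \<in> chart_dom E"
    using atlas unfolding smooth_atlas_def by blast
  then have "E \<in> smooth_charts A" using atlas unfolding smooth_atlas_def smooth_charts_def by blast
  then show ?thesis using that E smooth_charts_is_chart by blast
qed

lemma C11_at_transition:
  assumes "C \<in> smooth_charts A" "E \<in> A" "x \<in> chart_dom C" "x \<in> chart_dom E"
  shows "C11_at (transition C E) (chart_map C x)" "C11_at (transition E C) (chart_map E x)"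
proof -
  let ?W = "chart_dom C \<inter> chart_dom E"
  have ch: "is_chart C" "is_chart E"
    using assms(1,2) atlas by (auto simp: smooth_charts_def smooth_atlas_def)
  have op: "open (chart_map C ` ?W)" "open (chart_map E ` ?W)"
    using ch by (auto intro!: open_chart_map_image intro: chart_simps)
  have sm: "smooth_on (chart_map C ` ?W) (transition C E)" "smooth_on (chart_map E ` ?W) (transition E C)"
    using assms(1,2) by (auto simp: smooth_charts_def smooth_compatible_def)
  show "C11_at (transition C E) (chart_map C x)" "C11_at (transition E C) (chart_map E x)"
    using smooth_on_imp_C11_at[OF sm(1) op(1)] smooth_on_imp_C11_at[OF sm(2) op(2)] assms(3,4) by auto
qed

text \<open>Two charts of the maximal atlas are related through a chart of \<open>A\<close> around \<open>x\<close>, since compatibility is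
only postulated with charts of \<open>A\<close>.\<close>
lemma semiconcave_near_iff:
  assumes D: "D \<in> smooth_charts A" "x \<in> chart_dom D"
  shows "semiconcave_near f x \<longleftrightarrow> semiconcave_at (f \<circ> chart_inv D) (chart_map D x)"
proof
  assume "semiconcave_near f x"
  then obtain C where C: "C \<in> smooth_charts A" "x \<in> chart_dom C"
    and f: "semiconcave_at (f \<circ> chart_inv C) (chart_map C x)"
    unfolding semiconcave_near_def by blast
  obtain E where E: "E \<in> A" "is_chart E" "x \<in> chart_dom E" using chart_around by blast
  have "semiconcave_at (f \<circ> chart_inv E) (chart_map E x)"
    using semiconcave_at_change_chart[OF smooth_charts_is_chart[OF C(1)] E(2) C(2) E(3)]
      C11_at_transition(2)[OF C(1) E(1) C(2) E(3)] f by blast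
  then show "semiconcave_at (f \<circ> chart_inv D) (chart_map D x)"
    using semiconcave_at_change_chart[OF E(2) smooth_charts_is_chart[OF D(1)] E(3) D(2)]
      C11_at_transition(1)[OF D(1) E(1) D(2) E(3)] by blast
qed (use assms semiconcave_near_def in blast)

lemma C11_near_iff:
  assumes "D \<in> smooth_charts A" "x \<in> chart_dom D"
  shows "C11_near f x \<longleftrightarrow> C11_at (f \<circ> chart_inv D) (chart_map D x)"
  by (simp add: C11_near_def semiconcave_near_iff[OF assms] C11_at_iff_semiconcave o_def)

lemma semiconcave_near_cong:
  assumes "open S" "x \<in> S" "\<And>y. y \<in> S \<Longrightarrow> f y = g y" "semiconcave_near f x"
  shows "semiconcave_near g x"
proof -
  obtain E where E: "E \<in> smooth_charts A" "is_chart E" "x \<in> chart_dom E" using chart_around by blast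
  have "semiconcave_at (g \<circ> chart_inv E) (chart_map E x)"
  proof (rule semiconcave_at_cong)
    show "open (chart_map E ` (chart_dom E \<inter> S))"
      using E assms(1) by (auto intro!: open_chart_map_image intro: chart_simps)
    show "semiconcave_at (f \<circ> chart_inv E) (chart_map E x)"
      using assms(4) semiconcave_near_iff[OF E(1,3)] by simp
  qed (use E assms in \<open>auto simp: chart_simps\<close>)
  then show ?thesis using semiconcave_near_iff[OF E(1,3)] by simp
qed

lemma C11_near_cong:
  assumes "open S" "x \<in> S" "\<And>y. y \<in> S \<Longrightarrow> f y = g y" "C11_near f x"
  shows "C11_near g x"
  using assms(4) semiconcave_near_cong[OF assms(1,2), of f g]
    semiconcave_near_cong[OF assms(1,2), of "\<lambda>y. - f y" "\<lambda>y. - g y"] assms(3)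
  by (simp add: C11_near_def)

lemma semiconcave_near_min:
  assumes "semiconcave_near f x" "semiconcave_near g x"
  shows "semiconcave_near (\<lambda>y. min (f y) (g y)) x"
proof -
  obtain E where E: "E \<in> smooth_charts A" "x \<in> chart_dom E" using chart_around by blast
  show ?thesis
    using assms semiconcave_at_min[of "f \<circ> chart_inv E" "chart_map E x" "g \<circ> chart_inv E"]
    by (simp add: semiconcave_near_iff[OF E] o_def)
qed

lemma C11_near_const: "C11_near (\<lambda>y. a) x"
proof -
  obtain E where E: "E \<in> smooth_charts A" "x \<in> chart_dom E" using chart_around by blast
  show ?thesis by (simp add: C11_near_iff[OF E] o_def C11_at_const)
qed

lemma C11_near_add: "C11_near f x \<Longrightarrow> C11_near g x \<Longrightarrow> C11_near (\<lambda>y. f y + g y) x"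
proof -
  obtain E where E: "E \<in> smooth_charts A" "x \<in> chart_dom E" using chart_around by blast
  show "C11_near f x \<Longrightarrow> C11_near g x \<Longrightarrow> C11_near (\<lambda>y. f y + g y) x"
    by (simp add: C11_near_iff[OF E] o_def C11_at_add)
qed

lemma C11_near_diff: "C11_near f x \<Longrightarrow> C11_near g x \<Longrightarrow> C11_near (\<lambda>y. f y - g y) x"
proof -
  obtain E where E: "E \<in> smooth_charts A" "x \<in> chart_dom E" using chart_around by blast
  show "C11_near f x \<Longrightarrow> C11_near g x \<Longrightarrow> C11_near (\<lambda>y. f y - g y) x"
    by (simp add: C11_near_iff[OF E] o_def C11_at_diff)
qed

lemma C11_near_mult: "C11_near f x \<Longrightarrow> C11_near g x \<Longrightarrow> C11_near (\<lambda>y. f y * g y) x"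
proof -
  obtain E where E: "E \<in> smooth_charts A" "x \<in> chart_dom E" using chart_around by blast
  show "C11_near f x \<Longrightarrow> C11_near g x \<Longrightarrow> C11_near (\<lambda>y. f y * g y) x"
    by (simp add: C11_near_iff[OF E] o_def C11_at_mult)
qed

lemma C11_near_sum: "(\<And>i. i \<in> I \<Longrightarrow> C11_near (f i) x) \<Longrightarrow> C11_near (\<lambda>y. \<Sum>i\<in>I. f i y) x"
  by (induction I rule: infinite_finite_induct) (auto intro: C11_near_const C11_near_add)

lemma C11_near_prod: "(\<And>i. i \<in> I \<Longrightarrow> C11_near (f i) x) \<Longrightarrow> C11_near (\<lambda>y. \<Prod>i\<in>I. f i y) x"
  by (induction I rule: infinite_finite_induct) (auto intro: C11_near_const C11_near_mult)

lemma C11_near_compose_chart_map: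
  assumes E: "E \<in> smooth_charts A" and y: "y \<in> chart_dom E" and s: "C11_at s (chart_map E y)"
  shows "C11_near (\<lambda>z. s (chart_map E z)) y"
proof -
  note [simp] = chart_simps[OF smooth_charts_is_chart[OF E]]
  have "semiconcave_at ((\<lambda>z. s (chart_map E z)) \<circ> chart_inv E) (chart_map E y)"
    by (rule semiconcave_at_cong[of "chart_img E" _ s])
      (use y s in \<open>auto simp: C11_at_iff_semiconcave\<close>)
  moreover have "semiconcave_at (\<lambda>p. - ((\<lambda>z. s (chart_map E z)) \<circ> chart_inv E) p) (chart_map E y)"
    by (rule semiconcave_at_cong[of "chart_img E" _ "\<lambda>p. - s p"])
      (use y s in \<open>auto simp: C11_at_iff_semiconcave\<close>)
  ultimately show ?thesis
    by (simp add: C11_near_iff[OF E y] C11_at_iff_semiconcave)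
qed

lemma locally_semiconcave_imp_near:
  assumes "locally_semiconcave A f"
  shows "semiconcave_near f x"
proof -
  obtain C G H where C: "C \<in> smooth_charts A" "x \<in> chart_dom C"
    and G: "concave_on (chart_img C) G" and H: "smooth_on (chart_img C) H"
    and f: "\<forall>y\<in>chart_dom C. f y = G (chart_map C y) + H (chart_map C y)"
    using assms unfolding locally_semiconcave_def by blast
  have ch: "is_chart C" using smooth_charts_is_chart[OF C(1)] .
  have p: "chart_map C x \<in> chart_img C" and op: "open (chart_img C)"
    using C(2) by (auto simp: chart_simps[OF ch])
  have "semiconcave_at (\<lambda>p. G p + H p) (chart_map C x)"
    using concave_on_imp_semiconcave_at[OF G op p]
      C11_at_imp_semiconcave_at(1)[OF smooth_on_imp_C11_at[OF H op p]]
    by (rule semiconcave_at_add)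
  then have "semiconcave_at (f \<circ> chart_inv C) (chart_map C x)"
    by (rule semiconcave_at_cong[OF op p, rotated]) (simp add: f chart_simps[OF ch])
  then show ?thesis using C semiconcave_near_def by blast
qed

lemma locally_C11_of_near:
  assumes "\<And>x. C11_near f x"
  shows "locally_C11 A f"
  unfolding locally_C11_def
proof (intro ballI C11_on_of_C11_at)
  fix C p assume C: "C \<in> smooth_charts A" and p: "p \<in> chart_img C"
  have ch: "is_chart C" using smooth_charts_is_chart[OF C] .
  have "chart_inv C p \<in> chart_dom C" "chart_map C (chart_inv C p) = p"
    using p by (auto simp: chart_simps[OF ch])
  then show "C11_at (f \<circ> chart_inv C) p"
    using assms[of "chart_inv C p"] C11_near_iff[OF C, of "chart_inv C p"] by simp
qed

lemma locally_C11_imp_continuous: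
  assumes "locally_C11 A f"
  shows "continuous_on UNIV f"
proof (rule continuous_at_imp_continuous_on, rule ballI)
  fix x
  obtain E where E: "E \<in> smooth_charts A" "is_chart E" "x \<in> chart_dom E" using chart_around by blast
  have "C11_on (chart_img E) (f \<circ> chart_inv E)" using assms E(1) by (simp add: locally_C11_def)
  then have "continuous_on (chart_img E) (f \<circ> chart_inv E)"
    unfolding C11_on_def by (meson continuous_at_imp_continuous_on has_derivative_continuous)
  then have "continuous_on (chart_dom E) ((f \<circ> chart_inv E) \<circ> chart_map E)"
    unfolding chart_img_def by (rule continuous_on_compose[OF chart_simps(3)[OF E(2)]])
  then have "continuous_on (chart_dom E) f"
    by (rule continuous_on_eq) (use E in \<open>simp add: chart_simps\<close>)
  then show "isCont f x"
    using E by (simp add: continuous_on_eq_continuous_at chart_simps(1))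
qed

section \<open>Gluing and the insertion theorem of Ilmanen\<close>
text \<open>A bump function in a chart is extended by zero. The extension is \<open>C\<^sup>1\<^sup>,\<^sup>1\<close> across the boundary of the
chart domain because its support is the image of a compact ball, hence closed in the Hausdorff
space.\<close>
lemma C11_bump:
  assumes "open U" "x \<in> U"
  shows "\<exists>\<beta> V K. open V \<and> x \<in> V \<and> closed K \<and> K \<subseteq> U \<and> (\<forall>y. C11_near \<beta> y) \<and>
    (\<forall>y. 0 \<le> \<beta> y \<and> \<beta> y \<le> 1) \<and> (\<forall>y\<in>V. \<beta> y = 1) \<and> (\<forall>y. y \<notin> K \<longrightarrow> \<beta> y = 0)"
proof -
  obtain E where E: "E \<in> smooth_charts A" and ch: "is_chart E" and x: "x \<in> chart_dom E"
    using chart_around by blast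
  note [simp] = chart_simps[OF ch]
  let ?\<phi> = "chart_map E" and ?\<psi> = "chart_inv E"
  let ?W = "?\<phi> ` (chart_dom E \<inter> U)"
  have "open ?W" "?\<phi> x \<in> ?W"
    using assms x by (auto intro!: open_chart_map_image[OF ch])
  then obtain r where r: "r > 0" "cball (?\<phi> x) r \<subseteq> ?W"
    using open_contains_cball by blast
  have W: "?W \<subseteq> chart_img E" by auto
  define K where "K = ?\<psi> ` cball (?\<phi> x) r"
  have "compact K"
    unfolding K_def
    using r(2) W by (intro compact_continuous_image continuous_on_subset[OF chart_simps(4)[OF ch]]) auto
  then have K: "closed K" by (rule compact_imp_closed)
  have KU: "K \<subseteq> U" using r(2) by (auto simp: K_def)
  have inK: "y \<in> K" if "y \<in> chart_dom E" "dist (?\<phi> x) (?\<phi> y) \<le> r" for y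
    using that by (auto simp: K_def image_iff intro!: bexI[of _ "?\<phi> y"])
  \<comment> \<open>Equal to \<open>0\<close> outside the ball of radius \<open>r\<close> and to
    \<open>1\<close> on the ball of radius \<open>r / sqrt 3\<close>, which contains the one of
    radius \<open>r / 2\<close>.\<close>
  define s where "s p = C11_step (3 - (3 / r\<^sup>2) * (norm (p - ?\<phi> x))\<^sup>2)" for p
  define \<beta> where "\<beta> y = (if y \<in> chart_dom E then s (?\<phi> y) else 0)" for y
  define V where "V = chart_dom E \<inter> ?\<phi> -` ball (?\<phi> x) (r / 2)"
  have s: "C11_at s p" for p
    unfolding s_def
    by (rule C11_at_compose[OF C11_at_C11_step])
      (intro C11_at_diff C11_at_mult C11_at_const C11_at_norm_power2)
  have s0: "s p = 0" if "dist (?\<phi> x) p > r" for p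
  proof -
    have "r\<^sup>2 \<le> (norm (p - ?\<phi> x))\<^sup>2"
      using that r(1) by (intro power_mono) (auto simp: dist_norm norm_minus_commute)
    then show ?thesis
      unfolding s_def using r(1) by (intro C11_step_eq_0) (simp add: field_simps)
  qed
  have s1: "s p = 1" if "dist (?\<phi> x) p < r / 2" for p
  proof -
    have "(norm (p - ?\<phi> x))\<^sup>2 \<le> (r / 2)\<^sup>2"
      using that r(1) by (intro power_mono) (auto simp: dist_norm norm_minus_commute)
    then have "3 / r\<^sup>2 * (norm (p - ?\<phi> x))\<^sup>2 \<le> 3 / r\<^sup>2 * (r / 2)\<^sup>2"
      by (intro mult_left_mono) auto
    also have "\<dots> = 3 / 4" using r(1) by (simp add: power_divide)
    finally show ?thesis unfolding s_def by (intro C11_step_eq_1) simp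
  qed
  have zero: "\<beta> y = 0" if "y \<notin> K" for y
    using that inK[of y] s0[of "?\<phi> y"] unfolding \<beta>_def by (metis not_le)
  have "C11_near \<beta> y" for y
  proof (cases "y \<in> chart_dom E")
    case True
    then have "C11_near (\<lambda>y. s (?\<phi> y)) y" using E s by (intro C11_near_compose_chart_map)
    then show ?thesis
      by (rule C11_near_cong[rotated -1, of _ _ "chart_dom E"]) (use True in \<open>auto simp: \<beta>_def\<close>)
  next
    case False
    then have "y \<in> - K" using KU r(2) W by (auto simp: K_def)
    then show ?thesis
      by (rule C11_near_cong[where S = "- K" and f = "\<lambda>_. 0", rotated]) (use K zero in \<open>auto intro: C11_near_const\<close>)
  qed
  moreover have "open V" "x \<in> V"
    unfolding V_def using open_chart_map_vimage[OF ch] x r(1) by auto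
  moreover have "\<forall>y\<in>V. \<beta> y = 1" using s1 by (auto simp: V_def \<beta>_def)
  moreover have "\<forall>y. 0 \<le> \<beta> y \<and> \<beta> y \<le> 1" by (auto simp: \<beta>_def s_def C11_step_bounds)
  ultimately show ?thesis using K KU zero by blast
qed

text \<open>Local solutions of \<open>l \<le> k \<le> u\<close> are glued by an explicit partition of unity. For
countably many bumps \<open>b n\<close>, each equal to \<open>1\<close> on a member \<open>V n\<close> of an open cover, the functions
\<open>\<rho> n = b n * (\<Prod>j<n. 1 - b j)\<close> vanish on \<open>V m\<close> as soon as \<open>n > m\<close>, and their partial sums
\<open>1 - (\<Prod>j<n. 1 - b j)\<close> equal \<open>1\<close> there. The inequalities are preserved because the glued
function is pointwise a convex combination.\<close>
lemma C11_selection: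
  assumes "\<And>x. \<exists>U k. open U \<and> x \<in> U \<and> (\<forall>y\<in>U. C11_near k y \<and> l y \<le> k y \<and> k y \<le> u y)"
  obtains h where "\<And>y. C11_near h y" "\<And>y. l y \<le> h y" "\<And>y. h y \<le> u y"
proof -
  obtain U k where U: "\<And>x. open (U x)" "\<And>x. x \<in> U x"
    and k: "\<And>x y. y \<in> U x \<Longrightarrow> C11_near (k x) y \<and> l y \<le> k x y \<and> k x y \<le> u y"
    using assms by metis
  obtain \<beta> V K where V: "\<And>x. open (V x)" "\<And>x. x \<in> V x" and K: "\<And>x. closed (K x)" "\<And>x. K x \<subseteq> U x"
    and \<beta>: "\<And>x y. C11_near (\<beta> x) y" "\<And>x y. 0 \<le> \<beta> x y" "\<And>x y. \<beta> x y \<le> 1"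
    and \<beta>1: "\<And>x y. y \<in> V x \<Longrightarrow> \<beta> x y = 1" and \<beta>0: "\<And>x y. y \<notin> K x \<Longrightarrow> \<beta> x y = 0"
    using C11_bump[OF U] by metis
  obtain \<F> where \<F>: "\<F> \<subseteq> range V" "countable \<F>" "\<Union>\<F> = \<Union>(range V)"
    using Lindelof[of "range V"] V(1) by blast
  then obtain X where X: "countable X" "\<F> = V ` X"
    by (metis countable_subset_image)
  have cover: "(\<Union>x\<in>X. V x) = UNIV" using \<F>(3) X(2) V(2) by auto
  then have "X \<noteq> {}" by auto
  define a where "a = from_nat_into X"
  have cov: "\<exists>n. y \<in> V (a n)" for y
  proof -
    obtain x where "x \<in> X" "y \<in> V x" using cover by blast
    then show ?thesis using from_nat_into_surj[OF X(1)] unfolding a_def by metis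
  qed
  define \<rho> where "\<rho> n y = \<beta> (a n) y * (\<Prod>j<n. 1 - \<beta> (a j) y)" for n y
  have \<rho>sum: "(\<Sum>i<n. \<rho> i y) = 1 - (\<Prod>j<n. 1 - \<beta> (a j) y)" for n y
    by (induction n) (auto simp: \<rho>_def algebra_simps)
  have \<rho>nn: "0 \<le> \<rho> n y" for n y
    unfolding \<rho>_def using \<beta>(2,3) by (intro mult_nonneg_nonneg prod_nonneg) auto
  have prod0: "(\<Prod>j<n. 1 - \<beta> (a j) y) = 0" if "y \<in> V (a m)" "m < n" for m n y
    using that \<beta>1 by (intro prod_zero) auto
  define N where "N y = (LEAST n. y \<in> V (a n))" for y
  have N: "y \<in> V (a (N y))" for y unfolding N_def using LeastI_ex[OF cov] .
  \<comment> \<open>All later summands vanish at \<open>y\<close>, so the length of this sum may be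
    enlarged at will, and fixed locally.\<close>
  define h where "h y = (\<Sum>i<Suc (N y). \<rho> i y * k (a i) y)" for y
  have h: "h y = (\<Sum>i<Suc n. \<rho> i y * k (a i) y)" if "y \<in> V (a n)" for y n
  proof -
    have "N y \<le> n" unfolding N_def using that by (rule Least_le)
    moreover have "\<rho> i y = 0" if "N y < i" for i
      unfolding \<rho>_def using prod0[OF N that] by simp
    ultimately show ?thesis
      unfolding h_def by (intro sum.mono_neutral_left) auto
  qed
  have inU: "y \<in> U (a i)" if "\<rho> i y \<noteq> 0" for i y
    using that \<beta>0 K(2) unfolding \<rho>_def by (metis mult_zero_left subsetD)
  have summand: "C11_near (\<lambda>y. \<rho> i y * k (a i) y) y" for i y
  proof (cases "y \<in> U (a i)")
    case True
    then show ?thesis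
      unfolding \<rho>_def using k \<beta>(1) by (intro C11_near_mult C11_near_prod C11_near_diff C11_near_const) auto
  next
    case False
    then have "y \<in> - K (a i)" using K(2) by blast
    then show ?thesis
      by (rule C11_near_cong[where S = "- K (a i)" and f = "\<lambda>_. 0", rotated])
        (use K(1) \<beta>0 in \<open>auto simp: \<rho>_def intro: C11_near_const\<close>)
  qed
  have "C11_near h y" for y
    by (rule C11_near_cong[OF V(1) N, of _ "\<lambda>z. \<Sum>i<Suc (N y). \<rho> i z * k (a i) z"])
      (use h summand in \<open>auto intro!: C11_near_sum simp del: sum.lessThan_Suc\<close>)
  moreover have "l y \<le> h y" "h y \<le> u y" for y
  proof -
    have one: "(\<Sum>i<Suc (N y). \<rho> i y) = 1" unfolding \<rho>sum using prod0[OF N lessI] by simp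
    have "l y = (\<Sum>i<Suc (N y). \<rho> i y * l y)" using one by (simp only: sum_distrib_right[symmetric])
    also have "\<dots> \<le> h y"
      unfolding h_def
    proof (rule sum_mono)
      show "\<rho> i y * l y \<le> \<rho> i y * k (a i) y" for i
        using inU[of i y] k \<rho>nn[of i y] by (cases "\<rho> i y = 0") (auto intro!: mult_left_mono)
    qed
    finally show "l y \<le> h y" .
    have "h y \<le> (\<Sum>i<Suc (N y). \<rho> i y * u y)"
      unfolding h_def
    proof (rule sum_mono)
      show "\<rho> i y * k (a i) y \<le> \<rho> i y * u y" for i
        using inU[of i y] k \<rho>nn[of i y] by (cases "\<rho> i y = 0") (auto intro!: mult_left_mono)
    qed
    also have "\<dots> = u y" using one by (simp only: sum_distrib_right[symmetric])
    finally show "h y \<le> u y" .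
  qed
  ultimately show ?thesis using that by blast
qed

text \<open>Near each point a constant solves the problem.\<close>
lemma C11_between_continuous:
  assumes "continuous_on UNIV l" "continuous_on UNIV u" "\<And>x. l x < u x"
  obtains h where "\<And>y. C11_near h y" "\<And>y. l y \<le> h y" "\<And>y. h y \<le> u y"
proof (rule C11_selection)
  fix x
  define m where "m = (l x + u x) / 2"
  have "open ({y. l y < m} \<inter> {y. m < u y})"
    using assms(1,2) by (intro open_Int open_Collect_less continuous_on_const)
  moreover have "x \<in> {y. l y < m} \<inter> {y. m < u y}"
    using assms(3)[of x] by (simp add: m_def)
  ultimately show "\<exists>U k. open U \<and> x \<in> U \<and> (\<forall>y\<in>U. C11_near k y \<and> l y \<le> k y \<and> k y \<le> u y)"
    by (intro exI[of _ "{y. l y < m} \<inter> {y. m < u y}"] exI[of _ "\<lambda>_. m"]) (auto intro: C11_near_const)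
qed (use that in blast)

text \<open>Inserting a function between \<open>f\<close> and \<open>g\<close> is a local problem: in a chart it is solved by the convex
envelope construction, and the local solutions are glued.\<close>
theorem Ilmanen_insertion:
  assumes g: "\<And>x. semiconcave_near g x" and f: "\<And>x. semiconcave_near (\<lambda>y. - f y) x"
    and le: "\<And>x. f x \<le> g x"
  obtains h where "\<And>y. C11_near h y" "\<And>y. f y \<le> h y" "\<And>y. h y \<le> g y"
proof (rule C11_selection)
  fix x
  obtain E where E: "E \<in> smooth_charts A" and ch: "is_chart E" and x: "x \<in> chart_dom E"
    using chart_around by blast
  note [simp] = chart_simps[OF ch]
  let ?\<phi> = "chart_map E" and ?\<psi> = "chart_inv E"
  have sc: "semiconcave_at (g \<circ> ?\<psi>) (?\<phi> x)" "semiconcave_at (\<lambda>p. - (f \<circ> ?\<psi>) p) (?\<phi> x)"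
    using g[of x] f[of x] unfolding semiconcave_near_iff[OF E x] by (simp_all add: o_def)
  have le': "(f \<circ> ?\<psi>) p \<le> (g \<circ> ?\<psi>) p" for p using le by simp
  obtain h r where r: "r > 0" and h: "\<And>p. C11_at h p"
    and b: "\<And>p. p \<in> ball (?\<phi> x) r \<Longrightarrow> (f \<circ> ?\<psi>) p \<le> h p \<and> h p \<le> (g \<circ> ?\<psi>) p"
    by (rule C11_insertion_at[OF sc le']) blast
  let ?U = "chart_dom E \<inter> ?\<phi> -` ball (?\<phi> x) r"
  have "C11_near (\<lambda>y. h (?\<phi> y)) y" if "y \<in> chart_dom E" for y
    using E that h by (rule C11_near_compose_chart_map)
  moreover have "f y \<le> h (?\<phi> y) \<and> h (?\<phi> y) \<le> g y" if "y \<in> ?U" for y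
    using b[of "?\<phi> y"] that by auto
  moreover have "open ?U" "x \<in> ?U" using open_chart_map_vimage[OF ch] x r by auto
  ultimately show "\<exists>U k. open U \<and> x \<in> U \<and> (\<forall>y\<in>U. C11_near k y \<and> f y \<le> k y \<and> k y \<le> g y)"
    by (intro exI[of _ ?U] exI[of _ "\<lambda>y. h (?\<phi> y)"]) blast
qed (use that in blast)

end

section \<open>Subsolutions and the Whitney topology\<close>
lemma subsolution_le_lax_oleinik_minus:
  assumes "subsolution c u"
  shows "u x \<le> lax_oleinik_minus c u x"
  unfolding lax_oleinik_minus_def
  by (rule cINF_greatest) (use assms in \<open>auto simp: subsolution_def algebra_simps\<close>)

lemma lax_oleinik_plus_le_subsolution:
  assumes "subsolution c u"
  shows "lax_oleinik_plus c u x \<le> u x"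
  unfolding lax_oleinik_plus_def
  by (rule cSUP_least) (use assms in \<open>auto simp: subsolution_def algebra_simps\<close>)

lemma lax_oleinik_minus_le:
  assumes "subsolution c u"
  shows "lax_oleinik_minus c u x \<le> u y + c y x"
proof -
  have "bdd_below (range (\<lambda>y. u y + c y x))"
    using assms by (auto simp: subsolution_def bdd_below_def algebra_simps intro!: exI[of _ "u x"])
  then show ?thesis unfolding lax_oleinik_minus_def by (rule cINF_lower) simp
qed

lemma le_lax_oleinik_plus:
  assumes "subsolution c u"
  shows "u y - c x y \<le> lax_oleinik_plus c u x"
proof -
  have "bdd_above (range (\<lambda>y. u y - c x y))"
    using assms by (auto simp: subsolution_def bdd_above_def algebra_simps intro!: exI[of _ "u x"])
  then show ?thesis unfolding lax_oleinik_plus_def by (rule cSUP_upper[rotated]) simp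
qed

text \<open>A subsolution may be pushed up as far as \<open>lax_oleinik_minus c u\<close>: for such \<open>v\<close> and all \<open>x\<close>, \<open>y\<close>, \<open>v y \<le> lax_oleinik_minus c u y \<le> u x + c x y \<le> v x + c x y\<close>.\<close>
lemma subsolution_between_minus:
  assumes "subsolution c u" "\<And>x. u x \<le> v x" "\<And>x. v x \<le> lax_oleinik_minus c u x"
  shows "subsolution c v"
  unfolding subsolution_def
proof (intro allI)
  fix x y
  show "v y - v x \<le> c x y"
    using assms(2)[of x] assms(3)[of y] lax_oleinik_minus_le[OF assms(1), of y x] by linarith
qed

lemma subsolution_between_plus:
  assumes "subsolution c u" "\<And>x. lax_oleinik_plus c u x \<le> v x" "\<And>x. v x \<le> u x"
  shows "subsolution c v"
  unfolding subsolution_def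
proof (intro allI)
  fix x y
  show "v y - v x \<le> c x y"
    using assms(2)[of x] assms(3)[of y] le_lax_oleinik_plus[OF assms(1), of y x] by linarith
qed

text \<open>The sets generating the topology are a basis: a basic set around \<open>f\<close> that contains \<open>u\<close> also contains
the basic set around \<open>u\<close> whose width is the remaining slack \<open>\<epsilon> x - \<bar>f x - u x\<bar>\<close>.\<close>
lemma whitney_topology_neighbourhood:
  assumes "openin whitney_topology W" "u \<in> W"
  shows "\<exists>\<epsilon>. continuous_on UNIV \<epsilon> \<and> (\<forall>x. 0 < \<epsilon> x) \<and> whitney_basic \<epsilon> u \<subseteq> W"
proof -
  let ?B = "{whitney_basic \<epsilon> f |\<epsilon> f. continuous_on UNIV f \<and> continuous_on UNIV \<epsilon> \<and> (\<forall>x. 0 < \<epsilon> x)}"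
  have "generate_topology_on ?B W"
    using assms(1) unfolding whitney_topology_def openin_topology_generated_by_iff .
  then show ?thesis using assms(2)
  proof (induction W)
    case Empty
    then show ?case by simp
  next
    case (Int W1 W2)
    then obtain \<epsilon>1 \<epsilon>2 where e: "continuous_on UNIV \<epsilon>1" "\<forall>x. 0 < \<epsilon>1 x" "whitney_basic \<epsilon>1 u \<subseteq> W1"
      "continuous_on UNIV \<epsilon>2" "\<forall>x. 0 < \<epsilon>2 x" "whitney_basic \<epsilon>2 u \<subseteq> W2"
      by auto
    have "whitney_basic (\<lambda>x. min (\<epsilon>1 x) (\<epsilon>2 x)) u \<subseteq> W1 \<inter> W2"
      using e(3,6) by (auto simp: whitney_basic_def)
    moreover have "continuous_on UNIV (\<lambda>x. min (\<epsilon>1 x) (\<epsilon>2 x))"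
      using e(1,4) by (rule continuous_on_min)
    ultimately show ?case using e(2,5) by (intro exI[of _ "\<lambda>x. min (\<epsilon>1 x) (\<epsilon>2 x)"]) simp
  next
    case (UN \<U>)
    then show ?case by (meson Union_upper UnionE order_trans)
  next
    case (Basis W)
    then obtain \<epsilon> f where W: "W = whitney_basic \<epsilon> f" and f: "continuous_on UNIV f" "continuous_on UNIV \<epsilon>"
      by auto
    have u: "continuous_on UNIV u" "\<And>x. \<bar>f x - u x\<bar> < \<epsilon> x"
      using Basis(2) W by (auto simp: whitney_basic_def)
    have "whitney_basic (\<lambda>x. \<epsilon> x - \<bar>f x - u x\<bar>) u \<subseteq> W"
    proof
      fix h assume h: "h \<in> whitney_basic (\<lambda>x. \<epsilon> x - \<bar>f x - u x\<bar>) u"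
      have "\<bar>f x - h x\<bar> < \<epsilon> x" for x
      proof -
        have "\<bar>u x - h x\<bar> < \<epsilon> x - \<bar>f x - u x\<bar>" using h by (simp add: whitney_basic_def)
        then show ?thesis by linarith
      qed
      then show "h \<in> W" using h W by (simp add: whitney_basic_def)
    qed
    moreover have "continuous_on UNIV (\<lambda>x. \<epsilon> x - \<bar>f x - u x\<bar>)"
      using f u(1) by (intro continuous_intros)
    ultimately show ?case using u(2) by (intro exI[of _ "\<lambda>x. \<epsilon> x - \<bar>f x - u x\<bar>"]) simp
  qed
qed

lemma continuous_in_topspace_whitney:
  assumes "continuous_on UNIV u"
  shows "u \<in> topspace whitney_topology"
proof -
  have "u \<in> whitney_basic (\<lambda>_. 1) u" using assms by (simp add: whitney_basic_def)
  moreover have "openin whitney_topology (whitney_basic (\<lambda>_. 1) u)"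
    unfolding whitney_topology_def
    by (rule topology_generated_by_Basis) (use assms in \<open>auto intro!: exI continuous_on_const\<close>)
  ultimately show ?thesis by (meson openin_subset subsetD)
qed

text \<open>Truncating the two Lax-Oleinik operators by \<open>C\<^sup>1\<^sup>,\<^sup>1\<close> functions \<open>a \<le> u \<le> b\<close> close to \<open>u\<close> keeps
everything within \<open>\<epsilon>\<close> of \<open>u\<close> without destroying semiconcavity, respectively semiconvexity.
The result \<open>h\<close> of the insertion lies between \<open>lax_oleinik_plus c v\<close> and \<open>v\<close>, and so is a
subsolution.\<close>
lemma (in smooth_manifold) C11_subsolution_near:
  assumes minus: "\<And>u. subsolution c u \<Longrightarrow> locally_semiconcave A (lax_oleinik_minus c u)"
    and plus: "\<And>u. subsolution c u \<Longrightarrow> locally_semiconcave A (\<lambda>x. - lax_oleinik_plus c u x)"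
    and u: "continuous_on UNIV u" "subsolution c u"
    and \<epsilon>: "continuous_on UNIV \<epsilon>" "\<And>x. 0 < \<epsilon> x"
  obtains h where "locally_C11 A h" "subsolution c h" "\<And>x. \<bar>u x - h x\<bar> < \<epsilon> x"
proof -
  obtain a where a: "\<And>x. C11_near a x" "\<And>x. u x - \<epsilon> x / 2 \<le> a x" "\<And>x. a x \<le> u x"
    by (rule C11_between_continuous[of "\<lambda>x. u x - \<epsilon> x / 2" u])
      (use u(1) \<epsilon> in \<open>auto intro!: continuous_intros\<close>)
  obtain b where b: "\<And>x. C11_near b x" "\<And>x. u x \<le> b x" "\<And>x. b x \<le> u x + \<epsilon> x / 2"
    by (rule C11_between_continuous[of u "\<lambda>x. u x + \<epsilon> x / 2"])
      (use u(1) \<epsilon> in \<open>auto intro!: continuous_intros\<close>)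
  define v where "v x = min (lax_oleinik_minus c u x) (b x)" for x
  have uv: "u x \<le> v x" for x
    using b(2) subsolution_le_lax_oleinik_minus[OF u(2)] by (simp add: v_def)
  have v: "subsolution c v"
    by (rule subsolution_between_minus[OF u(2) uv]) (simp add: v_def)
  have v_semi: "semiconcave_near v x" for x
    unfolding v_def using locally_semiconcave_imp_near[OF minus[OF u(2)]] b(1)
    by (intro semiconcave_near_min) (auto simp: C11_near_def)
  define f where "f x = max (lax_oleinik_plus c v x) (a x)" for x
  have f_semi: "semiconcave_near (\<lambda>x. - f x) x" for x
  proof -
    have "semiconcave_near (\<lambda>x. min (- lax_oleinik_plus c v x) (- a x)) x"
      using locally_semiconcave_imp_near[OF plus[OF v]] a(1)
      by (intro semiconcave_near_min) (auto simp: C11_near_def)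
    then show ?thesis by (simp add: f_def minus_max_eq_min)
  qed
  have fv: "f x \<le> v x" for x
    using lax_oleinik_plus_le_subsolution[OF v, of x] a(3)[of x] uv[of x] by (simp add: f_def)
  obtain h where h: "\<And>x. C11_near h x" "\<And>x. f x \<le> h x" "\<And>x. h x \<le> v x"
    using Ilmanen_insertion[OF v_semi f_semi fv] by blast
  show ?thesis
  proof
    show "locally_C11 A h" using h(1) by (rule locally_C11_of_near)
    show "subsolution c h"
      by (rule subsolution_between_plus[OF v _ h(3)]) (use h(2) in \<open>simp add: f_def\<close>)
    fix x
    have "a x \<le> f x" "v x \<le> b x" by (simp_all add: f_def v_def)
    then show "\<bar>u x - h x\<bar> < \<epsilon> x"
      using a(2)[of x] b(3)[of x] h(2,3)[of x] \<epsilon>(2)[of x] by linarith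
  qed
qed

theorem theorem1:
  fixes A :: "('a::{t2_space, second_countable_topology}, 'e::euclidean_space) chart set"
    and g :: "('a, 'e) chart \<Rightarrow> 'a \<Rightarrow> 'e \<Rightarrow> 'e \<Rightarrow> real"
    and c :: "'a \<Rightarrow> 'a \<Rightarrow> real"
  assumes "connected_riemannian_manifold A g"
    and "\<And>u. subsolution c u \<Longrightarrow> locally_semiconcave A (lax_oleinik_minus c u)"
    and "\<And>u. subsolution c u \<Longrightarrow> locally_semiconcave A (\<lambda>x. - lax_oleinik_plus c u x)"
  shows "dense_subset whitney_topology
           {u. locally_C11 A u \<and> subsolution c u}
           {u. continuous_on UNIV u \<and> subsolution c u}"
proof -
  interpret smooth_manifold A
    using assms(1) by unfold_locales (simp add: connected_riemannian_manifold_def)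
  have "u \<in> whitney_topology closure_of {u. locally_C11 A u \<and> subsolution c u}"
    if u: "continuous_on UNIV u" "subsolution c u" for u
    unfolding in_closure_of
  proof (intro conjI allI impI)
    show "u \<in> topspace whitney_topology" using u(1) by (rule continuous_in_topspace_whitney)
    fix W assume "u \<in> W \<and> openin whitney_topology W"
    then obtain \<epsilon> where \<epsilon>: "continuous_on UNIV \<epsilon>" "\<And>x. 0 < \<epsilon> x" "whitney_basic \<epsilon> u \<subseteq> W"
      using whitney_topology_neighbourhood by metis
    obtain h where "locally_C11 A h" "subsolution c h" "\<And>x. \<bar>u x - h x\<bar> < \<epsilon> x"
      using C11_subsolution_near[OF assms(2,3) u \<epsilon>(1,2)] by blast
    then show "\<exists>h. h \<in> {u. locally_C11 A u \<and> subsolution c u} \<and> h \<in> W"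
      using \<epsilon>(3) locally_C11_imp_continuous by (auto simp: whitney_basic_def)
  qed
  then show ?thesis
    unfolding dense_subset_def using locally_C11_imp_continuous by auto
qed

end
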